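(* Let $\mu:\mathbb{R}^n\to\mathbb{R}^n$ and $\sigma:\mathbb{R}^n\to\mathbb{R}^{n\times n}$ be continuous with linear growth, and suppose that, for every $i=1,\dots,n$, $a_i^+(r)<\infty$ for all $r>0$ (with $a_i^+$ and the other notation as defined in the context). Assume further: (i) there is a neighbourhood $\mathcal{D}$ of $\partial\mathbb{R}^n_+$ such that $\mu_i(x)>0$ for all $x\in\mathcal{D}$, $i=1,\dots,n$; (ii) $b_i^-(r)>\frac1r$ for all $r>0$, $i=1,\dots,n$; (iii) there exists a function $\tilde\sigma:[0,\infty)\to\mathbb{R}$ such that $m_{ii}(x)\le n^3\,\tilde\sigma^2(p_i(x))$ for all $x\in\mathcal{D}\cap\mathbb{R}^n_+$ and $i=1,\dots,n$, where $\tilde\sigma$ satisfies: there exist $\epsilon>0$ and, for each $R>0$, a constant $C^1_R>0$ such that for all $r_1,r_2\in[0,R]$ with $|r_1-r_2|\le\epsilon$, $$|\tilde\sigma^2(r_1)-\tilde\sigma^2(r_2)|\le C_R^1|r_1-r_2|,\qquad |\sqrt{r_1}\,\tilde\sigma(r_1)-\sqrt{r_2}\,\tilde\sigma(r_2)|\le C_R^1\,\rho_1(|r_1-r_2|).$$ Let $X(\cdot)=(X_1(\cdot),\dots,X_n(\cdot))$ be a solution of $$dX(t)=\mu(X(t))\,dt+\sigma(X(t))\,dW(t)$$ with initial condition $X_i(0)=x_i>0$, $i=1,\dots,n$. Then with probability $1$ the paths of $X_i(\cdot)$ are positive (that is, $X_i(t)>0$ for all $t\ge0$), $i=1,\dot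s,n$.
   Context: $W(\cdot)$ is an $\mathbb{R}^n$-valued (standard) Wiener process. $\mathbb{R}^n_+=\{x\in\mathbb{R}^n : x_i>0\ \forall i\}$ is the (open) positive orthant and $\partial\mathbb{R}^n_+$ its boundary. $\rho_1:[0,\infty)\to\mathbb{R}$ is a fixed strictly increasing function with $\rho_1(0)=0$ and $\int_{0+}\frac{1}{\rho_1^2(s)}\,ds=\infty$. A function $f$ has linear growth if $|f(x)|\le K(1+|x|)$ for some constant $K$ and all $x$. Put $(m_{ij}(x))=\sigma(x)\sigma(x)^{\perp}$, where $\perp$ denotes transpose. For $i=1,\dots,n$ define functions $p_i,a_i,b_i:\mathbb{R}^n_+\to\mathbb{R}$ by $$p_i(x)=x_i,\qquad a_i(x)=m_{ii}(x),\qquad b_i(x)=\frac{\mu_i(x)}{a_i(x)}$$ (so it is implicit that $a_i$ does not vanish on $\mathbb{R}^n_+$). For $r>0$ define $$a_i^+(r)=\sup_{x\in\mathbb{R}^n_+:\,p_i(x)=r}a_i(x),\qquad b_i^-(r)=\inf_{x\in\mathbb{R}^n_+:\,p_i(x)=r}b_i(x).$$ *)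

theory Defs
  imports "HOL-Probability.Probability"
begin

section \<open>Filtered probability spaces and the Wiener process\<close>

text \<open>
  Time is modelled by the type \<open>real\<close>; only times \<open>t \<ge> 0\<close> are ever used. A filtration indexed by
  \<open>[0, \<infinity>)\<close> is extended to negative times by its value at \<open>0\<close>. Neither completeness nor
  right-continuity of the filtration is required.
\<close>

definition filtered_prob_space :: "'w measure \<Rightarrow> (real \<Rightarrow> 'w measure) \<Rightarrow> bool" where
  "filtered_prob_space M F \<longleftrightarrow>
     prob_space M \<and> filtration (space M) F \<and> (\<forall>t. subalgebra M (F t))"

definition adapted :: "(real \<Rightarrow> 'w measure) \<Rightarrow> (real \<Rightarrow> 'w \<Rightarrow> 'b::topological_space) \<Rightarrow> bool" where
  "adapted F Y \<longleftrightarrow> (\<forall>t\<ge>0. Y t \<in> borel_measurable (F t))"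

definition continuous_paths :: "'w measure \<Rightarrow> (real \<Rightarrow> 'w \<Rightarrow> 'b::topological_space) \<Rightarrow> bool" where
  "continuous_paths M Y \<longleftrightarrow> (AE \<omega> in M. continuous_on {0..} (\<lambda>t. Y t \<omega>))"

text \<open>
  The density below is that of the centred Gaussian law on \<open>\<real>\<^sup>n\<close> with covariance matrix
  \<open>(t - s) I\<close>; note that \<^const>\<open>normal_density\<close> takes the standard deviation as its parameter.
\<close>

definition wiener_process ::
    "'w measure \<Rightarrow> (real \<Rightarrow> 'w measure) \<Rightarrow> (real \<Rightarrow> 'w \<Rightarrow> real ^ 'n) \<Rightarrow> bool" where
  "wiener_process M F W \<longleftrightarrow>
     adapted F W \<and>
     continuous_paths M W \<and>
     (AE \<omega> in M. W 0 \<omega> = 0) \<and>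
     (\<forall>s t. 0 \<le> s \<and> s < t \<longrightarrow>
        distributed M lborel (\<lambda>\<omega>. W t \<omega> - W s \<omega>)
          (\<lambda>y. ennreal (\<Prod>i\<in>UNIV. normal_density 0 (sqrt (t - s)) (y $ i))) \<and>
        prob_space.indep_set M (sets (F s))
          {(\<lambda>\<omega>. W t \<omega> - W s \<omega>) -` B \<inter> space M | B. B \<in> sets borel})"


section \<open>The Ito integral\<close>

text \<open>
  A triple \<open>(N, \<tau>, \<xi>)\<close> encodes the integrand
  \<open>\<Sum>k<N. \<xi>\<^sub>k 1\<^bsub>(\<tau>\<^sub>k, \<tau>\<^sub>k\<^sub>+\<^sub>1]\<^esub>\<close>.
\<close>

type_synonym 'w simple_data = "nat \<times> (nat \<Rightarrow> real) \<times> (nat \<Rightarrow> 'w \<Rightarrow> real)"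

fun simple_process :: "'w measure \<Rightarrow> (real \<Rightarrow> 'w measure) \<Rightarrow> 'w simple_data \<Rightarrow> bool" where
  "simple_process M F (N, \<tau>, \<xi>) \<longleftrightarrow>
     0 \<le> \<tau> 0 \<and> (\<forall>k<N. \<tau> k \<le> \<tau> (Suc k)) \<and>
     (\<forall>k<N. \<xi> k \<in> borel_measurable (F (\<tau> k))) \<and>
     (\<exists>C. \<forall>k<N. \<forall>\<omega>\<in>space M. \<bar>\<xi> k \<omega>\<bar> \<le> C)"

fun simple_value :: "'w simple_data \<Rightarrow> real \<Rightarrow> 'w \<Rightarrow> real" where
  "simple_value (N, \<tau>, \<xi>) t \<omega> = (\<Sum>k<N. \<xi> k \<omega> * indicator {\<tau> k<..\<tau> (Suc k)} t)"

fun simple_integral :: "(real \<Rightarrow> 'w \<Rightarrow> real) \<Rightarrow> 'w simple_data \<Rightarrow> real \<Rightarrow> 'w \<Rightarrow> real" where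
  "simple_integral B (N, \<tau>, \<xi>) t \<omega> =
     (\<Sum>k<N. \<xi> k \<omega> * (B (min t (\<tau> (Suc k))) \<omega> - B (min t (\<tau> k)) \<omega>))"

text \<open>
  Convergence to \<open>0\<close> in probability, phrased with outer probability: paths are only assumed to be
  continuous almost surely and \<open>M\<close> need not be complete, so the exceptional sets need not belong to
  \<open>sets M\<close>, and \<^const>\<open>measure\<close> would then return the junk value \<open>0\<close> on them. For measurable
  \<open>D k\<close> this is the usual notion.
\<close>

definition tendsto_zero_in_prob :: "'w measure \<Rightarrow> (nat \<Rightarrow> 'w \<Rightarrow> ennreal) \<Rightarrow> bool" where
  "tendsto_zero_in_prob M D \<longleftrightarrow>
     (\<forall>\<epsilon>>0. \<forall>\<delta>>0. \<forall>\<^sub>F k in sequentially.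
        \<exists>A\<in>sets M. {\<omega> \<in> space M. ennreal \<epsilon> < D k \<omega>} \<subseteq> A \<and> measure M A < \<delta>)"

text \<open>
  \<open>has_ito_integral M F B H I\<close> says that \<open>I t\<close> is (a continuous version of) the Ito integral of \<open>H\<close>
  over \<open>[0, t]\<close> with respect to the real Wiener process \<open>B\<close>, for all \<open>t \<ge> 0\<close>. Here \<open>H\<close> is an adapted
  process with locally square integrable paths, and the integral is, as usual, the limit in
  probability, uniformly on compact time intervals, of the integrals of simple processes \<open>S k\<close>
  that approximate \<open>H\<close> in the sense that \<open>\<integral>\<^sub>0\<^sup>T (S k - H)\<^sup>2 ds \<rightarrow> 0\<close> in probability.
\<close>

definition has_ito_integral ::
    "'w measure \<Rightarrow> (real \<Rightarrow> 'w measure) \<Rightarrow> (real \<Rightarrow> 'w \<Rightarrow> real) \<Rightarrow>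
     (real \<Rightarrow> 'w \<Rightarrow> real) \<Rightarrow> (real \<Rightarrow> 'w \<Rightarrow> real) \<Rightarrow> bool" where
  "has_ito_integral M F B H I \<longleftrightarrow>
     adapted F H \<and>
     (AE \<omega> in M. set_borel_measurable lborel {0..} (\<lambda>s. H s \<omega>) \<and>
        (\<forall>T\<ge>0. (\<integral>\<^sup>+s\<in>{0..T}. ennreal ((H s \<omega>)\<^sup>2) \<partial>lborel) < \<infinity>)) \<and>
     continuous_paths M I \<and>
     (\<exists>S. (\<forall>k. simple_process M F (S k)) \<and>
        (\<forall>T\<ge>0.
           tendsto_zero_in_prob M
             (\<lambda>k \<omega>. \<integral>\<^sup>+s\<in>{0..T}. ennreal ((simple_value (S k) s \<omega> - H s \<omega>)\<^sup>2) \<partial>lborel) \<and>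
           tendsto_zero_in_prob M
             (\<lambda>k \<omega>. SUP t\<in>{0..T}. ennreal \<bar>simple_integral B (S k) t \<omega> - I t \<omega>\<bar>)))"


section \<open>Stochastic differential equations\<close>

text \<open>
  \<open>X\<close> solves \<open>dX = \<mu>(X) dt + \<sigma>(X) dW\<close>, written out in components;
  \<open>I i j\<close> is the Ito integral of \<open>\<sigma>\<^sub>i\<^sub>j(X)\<close> with respect to \<open>W\<^sub>j\<close>.
\<close>

definition sde_solution ::
    "'w measure \<Rightarrow> (real \<Rightarrow> 'w measure) \<Rightarrow> (real \<Rightarrow> 'w \<Rightarrow> real ^ 'n) \<Rightarrow>
     (real ^ 'n \<Rightarrow> real ^ 'n) \<Rightarrow> (real ^ 'n \<Rightarrow> real ^ 'n ^ 'n) \<Rightarrow>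
     (real \<Rightarrow> 'w \<Rightarrow> real ^ 'n) \<Rightarrow> bool" where
  "sde_solution M F W \<mu> \<sigma> X \<longleftrightarrow>
     adapted F X \<and>
     continuous_paths M X \<and>
     (\<exists>I. (\<forall>i j. has_ito_integral M F (\<lambda>t \<omega>. W t \<omega> $ j) (\<lambda>t \<omega>. \<sigma> (X t \<omega>) $ i $ j) (I i j)) \<and>
        (AE \<omega> in M. \<forall>t\<ge>0. \<forall>i.
           X t \<omega> $ i = X 0 \<omega> $ i + integral {0..t} (\<lambda>s. \<mu> (X s \<omega>) $ i) + (\<Sum>j\<in>UNIV. I i j t \<omega>)))"


section \<open>Coefficients on the positive orthant\<close>

definition linear_growth :: "('a::real_normed_vector \<Rightarrow> 'b::real_normed_vector) \<Rightarrow> bool" where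
  "linear_growth f \<longleftrightarrow> (\<exists>K. \<forall>x. norm (f x) \<le> K * (1 + norm x))"

definition pos_orthant :: "(real ^ 'n) set" where
  "pos_orthant = {x. \<forall>i. 0 < x $ i}"

definition nhd_of :: "'a::topological_space set \<Rightarrow> 'a set \<Rightarrow> bool" where
  "nhd_of D A \<longleftrightarrow> (\<exists>U. open U \<and> A \<subseteq> U \<and> U \<subseteq> D)"

definition m_fn :: "(real ^ 'n \<Rightarrow> real ^ 'n ^ 'n) \<Rightarrow> real ^ 'n \<Rightarrow> real ^ 'n ^ 'n" where
  "m_fn \<sigma> x = \<sigma> x ** transpose (\<sigma> x)"

definition p_fn :: "'n \<Rightarrow> real ^ 'n \<Rightarrow> real" where
  "p_fn i x = x $ i"

definition a_fn :: "(real ^ 'n \<Rightarrow> real ^ 'n ^ 'n) \<Rightarrow> 'n \<Rightarrow> real ^ 'n \<Rightarrow> real" where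
  "a_fn \<sigma> i x = m_fn \<sigma> x $ i $ i"

definition b_fn ::
    "(real ^ 'n \<Rightarrow> real ^ 'n) \<Rightarrow> (real ^ 'n \<Rightarrow> real ^ 'n ^ 'n) \<Rightarrow> 'n \<Rightarrow> real ^ 'n \<Rightarrow> real" where
  "b_fn \<mu> \<sigma> i x = \<mu> x $ i / a_fn \<sigma> i x"

text \<open>The extrema may be infinite, hence are taken in the extended reals.\<close>

definition a_plus :: "(real ^ 'n \<Rightarrow> real ^ 'n ^ 'n) \<Rightarrow> 'n \<Rightarrow> real \<Rightarrow> ereal" where
  "a_plus \<sigma> i r = (SUP x\<in>{x \<in> pos_orthant. p_fn i x = r}. ereal (a_fn \<sigma> i x))"

definition b_minus ::
    "(real ^ 'n \<Rightarrow> real ^ 'n) \<Rightarrow> (real ^ 'n \<Rightarrow> real ^ 'n ^ 'n) \<Rightarrow> 'n \<Rightarrow> real \<Rightarrow> ereal" where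
  "b_minus \<mu> \<sigma> i r = (INF x\<in>{x \<in> pos_orthant. p_fn i x = r}. ereal (b_fn \<mu> \<sigma> i x))"

end

theory Submission
  imports Defs
begin

text \<open>
  On the positive orthant the hypothesis on \<open>b_minus\<close> says \<open>\<mu>\<^sub>i x\<^sub>i > m\<^sub>i\<^sub>i\<close>, which makes the drift
  \<open>- \<mu>\<^sub>i / x\<^sub>i\<^sup>2 + m\<^sub>i\<^sub>i / x\<^sub>i\<^sup>3\<close> of \<open>1 / X\<^sub>i\<close> negative: up to the exit from the orthant \<open>1 / X\<^sub>i\<close> is a
  nonnegative local supermartingale, so \<open>X\<^sub>i\<close> reaches level \<open>\<epsilon>\<close> with probability at most
  \<open>\<epsilon> / X\<^sub>i(0)\<close>.

  Ito's formula is replaced by a Taylor estimate along a fine time grid. The Ito integrals are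
  approximated by integrals of simple processes, whose increments over a grid cell avoiding the
  jump times are conditionally Gaussian. The resulting Euler sums are frozen as soon as, at a grid
  point, \<open>X\<close> leaves a bounded part of the orthant, \<open>X\<^sub>i\<close> falls below \<open>\<epsilon>\<close>, or the approximation
  becomes bad; freezing bounds all coefficients. Markov's inequality and letting the mesh tend to \<open>0\<close>
  along each path give the claim.
\<close>

section \<open>Gaussian increments\<close>

text \<open>The obstacle is that an Ito integral is given only as a limit in probability, so its
  increments come with no moment bounds. Moments are at hand for simple integrands, but these carry
  a bound \<open>C\<close> that nothing controls as the approximation improves. The order of the
  choices resolves this. The level \<epsilon> and the tolerances \<theta>, \<delta>,
  \<open>a\<close>, \<open>w\<close> are fixed from the wanted probability; then come the simple
  processes, and with them \<open>C\<close>; the mesh comes last. \<open>C\<close> enters only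
  through the Taylor error, of order d^(3/2) per unit of mesh \<open>d\<close> and cell, hence sqrt
  d in total, which vanishes while \<open>C\<close> stays fixed. Components can be treated one at a
  time: at the first exit from the orthant some component is at most 0, while before it all
  components are positive, so the drift inequality is available up to that time. How fine the grid
  must be depends on the modulus of continuity of the path, so a bad path is detected on all
  sufficiently fine grids rather than on one prescribed grid; hence the limit inferior of
  events.\<close>

lemma lborel_vec_prod:
  fixes f :: "'n::finite \<Rightarrow> real \<Rightarrow> real"
  assumes f: "\<And>i. integrable lborel (f i)"
  shows "integrable lborel (\<lambda>y::real^'n. \<Prod>i\<in>UNIV. f i (y $ i))"
    and "(\<integral>y. (\<Prod>i\<in>UNIV. f i ((y::real^'n) $ i)) \<partial>lborel) = (\<Prod>i\<in>UNIV. \<integral>x. f i x \<partial>lborel)"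
proof -
  interpret product_sigma_finite "\<lambda>b::real^'n. lborel :: real measure" ..
  \<comment> \<open>\<open>lborel\<close> is a product over \<open>Basis\<close>, so
    \<open>g\<close> moves the index from components to basis vectors by inverting
    \<open>axis _ 1\<close>.\<close>
  define g :: "real^'n \<Rightarrow> real \<Rightarrow> real" where "g b = f (THE i. b = axis i 1)" for b
  have the: "(THE i'. axis i (1::real) = axis i' 1) = i" for i :: 'n
    by (rule the_equality) (auto simp: axis_eq_axis)
  have g_axis: "g (axis i 1) = f i" for i by (simp add: g_def the)
  have Basis: "(Basis :: (real^'n) set) = range (\<lambda>i. axis i 1)" by (auto simp: Basis_vec_def)
  have inj: "inj (\<lambda>i::'n. axis i (1::real))" by (auto simp: inj_def axis_eq_axis)
  have g: "integrable lborel (g b)" if "b \<in> Basis" for b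
    using that f by (auto simp: Basis g_axis)
  have comp: "(\<Sum>b\<in>Basis. x b *\<^sub>R b) $ i = x (axis i 1)" for x and i :: 'n
  proof -
    have "(\<Sum>b\<in>Basis. x b *\<^sub>R b) $ i = (\<Sum>k\<in>UNIV. x (axis k 1) * axis k 1 $ i)"
      by (simp add: Basis sum.reindex[OF inj])
    also have "\<dots> = (\<Sum>k\<in>UNIV. if k = i then x (axis k 1) else 0)"
      by (intro sum.cong) (auto simp: axis_def)
    finally show ?thesis by simp
  qed
  have eq: "(\<Prod>i\<in>UNIV. f i ((\<Sum>b\<in>Basis. x b *\<^sub>R b) $ i)) = (\<Prod>b\<in>Basis. g b (x b))" for x
    unfolding comp by (simp add: Basis prod.reindex[OF inj] g_axis)
  have [measurable]: "f i \<in> borel_measurable borel" for i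
    using borel_measurable_integrable[OF f[of i]] by simp
  have m: "(\<lambda>y::real^'n. \<Prod>i\<in>UNIV. f i (y $ i)) \<in> borel_measurable borel" by measurable
  have m2: "(\<lambda>x. \<Sum>b\<in>Basis. x b *\<^sub>R b) \<in> (\<Pi>\<^sub>M b\<in>(Basis::(real^'n) set). (lborel::real measure)) \<rightarrow>\<^sub>M borel"
    by measurable
  show "integrable lborel (\<lambda>y::real^'n. \<Prod>i\<in>UNIV. f i (y $ i))"
    unfolding lborel_eq[where 'a="real^'n"] integrable_distr_eq[OF m2 m] eq
    by (rule product_integrable_prod) (auto intro: g)
  show "(\<integral>y. (\<Prod>i\<in>UNIV. f i ((y::real^'n) $ i)) \<partial>lborel) = (\<Prod>i\<in>UNIV. \<integral>x. f i x \<partial>lborel)"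
    unfolding lborel_eq[where 'a="real^'n"] integral_distr[OF m2 m] eq
    by (subst product_integral_prod) (auto intro: g simp: Basis prod.reindex[OF inj] g_axis)
qed

text \<open>The law N(0, d I), in the form used by \<open>wiener_process\<close>: \<open>d\<close>
  is the variance of a component.\<close>

definition gaussian_vec :: "'w measure \<Rightarrow> real \<Rightarrow> ('w \<Rightarrow> real^'n) \<Rightarrow> bool" where
  "gaussian_vec M d Z \<longleftrightarrow> distributed M lborel Z
     (\<lambda>y. ennreal (\<Prod>i\<in>UNIV. normal_density 0 (sqrt d) (y $ i)))"

lemma gaussian_vec_measurable: "gaussian_vec M d Z \<Longrightarrow> Z \<in> borel_measurable M"
  unfolding gaussian_vec_def distributed_def by simp

lemma gaussian_vec_prod:
  fixes f :: "'n::finite \<Rightarrow> real \<Rightarrow> real"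
  assumes Z: "gaussian_vec M d Z"
    and f: "\<And>i. integrable lborel (\<lambda>x. normal_density 0 (sqrt d) x * f i x)"
    and [measurable]: "\<And>i. f i \<in> borel_measurable borel"
  shows "integrable M (\<lambda>\<omega>. \<Prod>i\<in>UNIV. f i (Z \<omega> $ i))"
    and "(\<integral>\<omega>. (\<Prod>i\<in>UNIV. f i (Z \<omega> $ i)) \<partial>M) =
      (\<Prod>i\<in>UNIV. \<integral>x. normal_density 0 (sqrt d) x * f i x \<partial>lborel)"
proof -
  have nn: "0 \<le> (\<Prod>i\<in>UNIV. normal_density 0 (sqrt d) ((y::real^'n) $ i))" for y
    by (intro prod_nonneg) auto
  have m: "(\<lambda>y. \<Prod>i\<in>UNIV. f i ((y::real^'n) $ i)) \<in> borel_measurable lborel" by measurable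
  show "integrable M (\<lambda>\<omega>. \<Prod>i\<in>UNIV. f i (Z \<omega> $ i))"
    using distributed_integrable[OF Z[unfolded gaussian_vec_def] m nn]
      lborel_vec_prod(1)[where f = "\<lambda>i x. normal_density 0 (sqrt d) x * f i x", OF f] by (simp add: prod.distrib)
  show "(\<integral>\<omega>. (\<Prod>i\<in>UNIV. f i (Z \<omega> $ i)) \<partial>M) =
      (\<Prod>i\<in>UNIV. \<integral>x. normal_density 0 (sqrt d) x * f i x \<partial>lborel)"
    using distributed_integral[OF Z[unfolded gaussian_vec_def] m nn]
      lborel_vec_prod(2)[where f = "\<lambda>i x. normal_density 0 (sqrt d) x * f i x", OF f] by (simp add: prod.distrib)
qed

lemma gaussian_vec_component:
  assumes Z: "gaussian_vec M d Z" and d: "0 < d"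
    and g: "has_bochner_integral lborel (\<lambda>x. normal_density 0 (sqrt d) x * g x) c"
    and [measurable]: "g \<in> borel_measurable borel"
  shows "has_bochner_integral M (\<lambda>\<omega>. g (Z \<omega> $ j)) c"
proof -
  \<comment> \<open>All factors except the one at \<open>j\<close> are 1, so their integrals are the
    total mass of a normal density.\<close>
  define f where "f i = (if i = j then g else (\<lambda>_. 1))" for i
  have P: "(\<Prod>i\<in>UNIV. f i (z i)) = g (z j)" for z
    by (subst prod.remove[of _ j]) (auto simp: f_def)
  have f: "integrable lborel (\<lambda>x. normal_density 0 (sqrt d) x * f i x)" for i
    using g d by (auto simp: f_def intro: integrable.intros)
  have fm: "f i \<in> borel_measurable borel" for i by (simp add: f_def)
  note G = gaussian_vec_prod[where f = f, OF Z f fm]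
  have "(\<Prod>i\<in>UNIV. \<integral>x. normal_density 0 (sqrt d) x * f i x \<partial>lborel) = c"
    using d has_bochner_integral_integral_eq[OF g]
    by (subst prod.remove[of _ j]) (auto simp: f_def)
  then show ?thesis using G unfolding P by (simp add: has_bochner_integral_iff)
qed

text \<open>Mean and covariance produce the first and second order Ito terms exactly; the third
  absolute moment is there for the Taylor remainder.\<close>

lemma gaussian_vec_moments:
  assumes Z: "gaussian_vec M d Z" and d: "0 < d"
  shows gaussian_vec_mean: "has_bochner_integral M (\<lambda>\<omega>. Z \<omega> $ j) 0"
    and gaussian_vec_cov: "has_bochner_integral M (\<lambda>\<omega>. Z \<omega> $ j * Z \<omega> $ k) (if j = k then d else 0)"
    and gaussian_vec_cube: "has_bochner_integral M (\<lambda>\<omega>. \<bar>Z \<omega> $ j\<bar>^3) (2 * d * sqrt d * sqrt (2 / pi))"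
proof -
  have s: "0 < sqrt d" using d by simp
  have m1: "has_bochner_integral lborel (\<lambda>x. normal_density 0 (sqrt d) x * x) 0"
    using normal_moment_odd[OF s, of 0 0] by simp
  show "has_bochner_integral M (\<lambda>\<omega>. Z \<omega> $ j) 0"
    by (rule gaussian_vec_component[OF Z d m1]) auto
  have m2: "has_bochner_integral lborel (\<lambda>x. normal_density 0 (sqrt d) x * x^2) d"
    using normal_moment_even[OF s, of 0 1] d by (simp add: power2_eq_square)
  have m3: "has_bochner_integral lborel (\<lambda>x. normal_density 0 (sqrt d) x * \<bar>x\<bar>^3) (2 * d * sqrt d * sqrt (2 / pi))"
  proof -
    have "2 ^ 1 * sqrt d ^ (2 * 1 + 1) * fact 1 * sqrt (2 / pi) = 2 * d * sqrt d * sqrt (2 / pi)"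
      using d by (simp add: numeral_3_eq_3)
    with normal_moment_abs_odd[OF s, of 0 1] show ?thesis by (simp only: diff_0_right) simp
  qed
  show "has_bochner_integral M (\<lambda>\<omega>. \<bar>Z \<omega> $ j\<bar>^3) (2 * d * sqrt d * sqrt (2 / pi))"
    by (rule gaussian_vec_component[OF Z d m3]) auto
  show "has_bochner_integral M (\<lambda>\<omega>. Z \<omega> $ j * Z \<omega> $ k) (if j = k then d else 0)"
  proof (cases "j = k")
    case True
    then show ?thesis
      using gaussian_vec_component[OF Z d m2, of j] by (simp add: power2_eq_square)
  next
    case False
    define f :: "'b \<Rightarrow> real \<Rightarrow> real" where "f i = (if i = j \<or> i = k then (\<lambda>x. x) else (\<lambda>_. 1))" for i
    have P: "(\<Prod>i\<in>UNIV. f i (z i)) = z j * z k" for z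
    proof -
      have "(\<Prod>i\<in>UNIV. f i (z i)) = f j (z j) * (f k (z k) * (\<Prod>i\<in>UNIV - {j} - {k}. f i (z i)))"
        using False by (simp add: prod.remove[of UNIV j] prod.remove[of "UNIV - {j}" k])
      also have "(\<Prod>i\<in>UNIV - {j} - {k}. f i (z i)) = 1"
        by (rule prod.neutral) (auto simp: f_def)
      finally show ?thesis by (simp add: f_def)
    qed
    have f: "integrable lborel (\<lambda>x. normal_density 0 (sqrt d) x * f i x)" for i
      using m1 d by (auto simp: f_def intro: integrable.intros)
    have fm: "f i \<in> borel_measurable borel" for i by (simp add: f_def)
    note G = gaussian_vec_prod[where f = f, OF Z f fm]
    \<comment> \<open>As \<open>j \<noteq> k\<close>, the factor at \<open>j\<close> is the mean,
      which is 0.\<close>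
    have "(\<Prod>i\<in>UNIV. \<integral>x. normal_density 0 (sqrt d) x * f i x \<partial>lborel) = 0"
      using has_bochner_integral_integral_eq[OF m1] by (auto simp: prod_zero_iff f_def)
    then show ?thesis using G False unfolding P by (simp add: has_bochner_integral_iff)
  qed
qed

text \<open>Takes the place of conditioning on \<open>G\<close>: a \<open>G\<close>-measurable
  coefficient factors out of the expectation of a function of an independent increment. The bound on
  \<open>U\<close> supplies its integrability.\<close>

lemma (in prob_space) indep_expectation_product:
  fixes Z :: "'a \<Rightarrow> 'b::{second_countable_topology, t2_space}" and U :: "'a \<Rightarrow> real"
  assumes sub: "subalgebra M G" and Z[measurable]: "Z \<in> borel_measurable M"
    and ind: "indep_set (sets G) {Z -` B \<inter> space M | B. B \<in> sets borel}"
    and U: "U \<in> borel_measurable G" and bd: "\<And>\<omega>. \<omega> \<in> space M \<Longrightarrow> \<bar>U \<omega>\<bar> \<le> c"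
    and g[measurable]: "g \<in> borel_measurable borel"
    and hb: "has_bochner_integral M (\<lambda>\<omega>. g (Z \<omega>)) e"
  shows "has_bochner_integral M (\<lambda>\<omega>. U \<omega> * g (Z \<omega>)) (expectation U * e)"
proof -
  have UM[measurable]: "U \<in> borel_measurable M"
    using measurable_from_subalg[OF sub U] .
  have "indep_set (sigma_sets (space M) {U -` A \<inter> space M |A. A \<in> sets borel})
     (sigma_sets (space M) {(\<lambda>\<omega>. g (Z \<omega>)) -` A \<inter> space M |A. A \<in> sets borel})"
    \<comment> \<open>Independence passes from two Int-stable families to the sigma-algebras they
      generate, and from there down to those generated by \<open>U\<close> and by \<open>g\<close>
      of \<open>Z\<close>.\<close>
    unfolding indep_set_def
  proof (rule indep_sets_mono_sets[OF indep_set_sigma_sets[OF ind, unfolded indep_set_def]])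
    show "Int_stable (sets G)" by (simp add: sets.Int_stable)
    have "\<exists>D. Z -` B \<inter> space M \<inter> (Z -` C \<inter> space M) = Z -` D \<inter> space M \<and> D \<in> sets borel"
      if "B \<in> sets borel" "C \<in> sets borel" for B C
      using that by (intro exI[of _ "B \<inter> C"]) auto
    then show "Int_stable {Z -` B \<inter> space M | B. B \<in> sets borel}"
      by (auto simp: Int_stable_def)
    fix b :: bool assume "b \<in> UNIV"
    have 1: "sigma_sets (space M) {U -` A \<inter> space M |A. A \<in> sets borel} \<subseteq> sigma_sets (space M) (sets G)"
      using measurable_sets[OF U] sub
      by (intro sigma_sets_mono') (auto simp: subalgebra_def)
    have "(\<lambda>\<omega>. g (Z \<omega>)) -` A = Z -` (g -` A)" for A by auto
    moreover have "g -` A \<in> sets borel" if "A \<in> sets borel" for A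
      using measurable_sets[OF g that] by simp
    ultimately have 2: "sigma_sets (space M) {(\<lambda>\<omega>. g (Z \<omega>)) -` A \<inter> space M |A. A \<in> sets borel}
       \<subseteq> sigma_sets (space M) {Z -` B \<inter> space M | B. B \<in> sets borel}"
      by (intro sigma_sets_mono') auto
    show "(case b of True \<Rightarrow> sigma_sets (space M) {U -` A \<inter> space M |A. A \<in> sets borel}
          | False \<Rightarrow> sigma_sets (space M) {(\<lambda>\<omega>. g (Z \<omega>)) -` A \<inter> space M |A. A \<in> sets borel})
        \<subseteq> (case b of True \<Rightarrow> sigma_sets (space M) (sets G)
          | False \<Rightarrow> sigma_sets (space M) {Z -` B \<inter> space M | B. B \<in> sets borel})"
      using 1 2 by (cases b) auto
  qed
  then have iv: "indep_var borel U borel (\<lambda>\<omega>. g (Z \<omega>))"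
    unfolding indep_var_eq by simp
  have iU: "integrable M U" by (rule integrable_const_bound[of _ c]) (auto simp: bd)
  have ig: "integrable M (\<lambda>\<omega>. g (Z \<omega>))" using hb by (rule integrable.intros)
  show ?thesis
    using indep_var_integrable[OF iv iU ig] indep_var_lebesgue_integral[OF iv iU ig]
      has_bochner_integral_integral_eq[OF hb] by (simp add: has_bochner_integral_iff)
qed

section \<open>Expectation of the reciprocal along an Euler scheme\<close>

lemma borel_measurable_vec_component [measurable (raw)]:
  fixes f :: "'a \<Rightarrow> real^'n"
  assumes "f \<in> borel_measurable M"
  shows "(\<lambda>\<omega>. f \<omega> $ j) \<in> borel_measurable M"
  by (rule measurable_compose[OF assms]) (intro borel_measurable_continuous_onI continuous_intros)

text \<open>
  Truncating \<open>1 / y\<close> to \<open>1 / max y e\<close> keeps it bounded, so that no integrability has to be proved,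
  while \<open>1 / y\<close> and its derivatives are still exact at the base point \<open>v\<close>.
\<close>

lemma inverse_max_taylor:
  fixes e v h :: real
  assumes e: "0 < e" and v: "2 * e \<le> v"
  shows "1 / max (v + h) e \<le> 1 / v - h / v\<^sup>2 + h\<^sup>2 / v^3 + \<bar>h\<bar>^3 / e^4"
proof (cases "e \<le> v + h")
  case True
  define u where "u = v + h"
  have u: "e \<le> u" "0 < u" and v0: "0 < v" "e \<le> v" using True e v by (auto simp: u_def)
  have h: "h = u - v" by (simp add: u_def)
  \<comment> \<open>An exact geometric expansion of 1 / u around \<open>v\<close>, remainder
    included.\<close>
  have "1 / u = 1 / v - h / v\<^sup>2 + h\<^sup>2 / v^3 - h^3 / (v^3 * u)"
    using u v0 unfolding h by (simp add: field_simps power2_eq_square power3_eq_cube)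
  moreover have "- (h^3) / (v^3 * u) \<le> \<bar>h\<bar>^3 / (v^3 * u)"
    using u v0 by (intro divide_right_mono) (auto simp: power_abs[symmetric])
  moreover have "\<bar>h\<bar>^3 / (v^3 * u) \<le> \<bar>h\<bar>^3 / (e^3 * e)"
    using u v0 e by (intro divide_left_mono mult_mono power_mono mult_pos_pos) auto
  moreover have "e^3 * e = e^4" by (simp add: power_numeral_reduce)
  moreover have "max (v + h) e = u" using True by (simp add: u_def)
  ultimately show ?thesis by simp
next
  case False
  \<comment> \<open>When the truncation is active the increment is negative and larger than
    \<open>e\<close> in size. The cubic term alone then dominates 1 / e, and the remaining terms are
    nonnegative.\<close>
  then have h: "e < - h" using v by linarith
  have v0: "0 < v" using e v by linarith
  have "e^3 \<le> \<bar>h\<bar>^3" using h e by (intro power_mono) auto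
  then have "e^3 / e^4 \<le> \<bar>h\<bar>^3 / e^4" using e by (intro divide_right_mono) auto
  moreover have "e^3 / e^4 = 1 / e" using e by (simp add: field_simps power_numeral_reduce)
  moreover have "0 \<le> 1 / v" "0 \<le> - h / v\<^sup>2" "0 \<le> h\<^sup>2 / v^3"
    using h v0 e by (intro divide_nonneg_nonneg; simp)+
  moreover have "- h / v\<^sup>2 = - (h / v\<^sup>2)" by simp
  moreover have "max (v + h) e = e" using False by simp
  ultimately show ?thesis by linarith
qed

lemma add_cube_le: "0 \<le> x \<Longrightarrow> 0 \<le> y \<Longrightarrow> (x + y)^3 \<le> 8 * (x^3 + y^3)" for x y :: real
proof -
  assume xy: "0 \<le> x" "0 \<le> y"
  have "(x + y)^3 \<le> (2 * max x y)^3" using xy by (intro power_mono) auto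
  also have "\<dots> = 8 * (max x y)^3" by (simp add: power_mult_distrib)
  also have "\<dots> \<le> 8 * (x^3 + y^3)" using xy by (auto simp: max_def)
  finally show ?thesis .
qed

lemma sum_cube_le:
  fixes f :: "'a::finite \<Rightarrow> real"
  assumes f: "\<And>i. 0 \<le> f i"
  shows "(\<Sum>i\<in>UNIV. f i)^3 \<le> real CARD('a)^3 * (\<Sum>i\<in>UNIV. f i^3)"
proof -
  obtain k where k: "\<And>i. f i \<le> f k"
  proof -
    have "Max (range f) \<in> range f" by (intro Max_in) auto
    then obtain k where "Max (range f) = f k" by (rule imageE)
    moreover have "f i \<le> Max (range f)" for i by (intro Max_ge) auto
    ultimately show ?thesis using that by metis
  qed
  have "(\<Sum>i\<in>UNIV. f i) \<le> real CARD('a) * f k"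
    using sum_bounded_above[of UNIV f "f k"] k by simp
  then have "(\<Sum>i\<in>UNIV. f i)^3 \<le> (real CARD('a) * f k)^3"
    using f by (intro power_mono) (auto intro: sum_nonneg)
  also have "\<dots> = real CARD('a)^3 * f k^3" by (simp add: power_mult_distrib)
  also have "\<dots> \<le> real CARD('a)^3 * (\<Sum>i\<in>UNIV. f i^3)"
    using member_le_sum[of k UNIV "\<lambda>i. f i^3"] f by (intro mult_left_mono) auto
  finally show ?thesis .
qed

text \<open>The first summand bounds the squared drift term over V^3. The second is the Taylor
  remainder: 8 comes from \<open>add_cube_le\<close>, 1 from d^3, and 2 n^4 from n^3 times
  \<open>n\<close> third moments, with sqrt (2 / pi) estimated by 1.\<close>

definition step_error :: "nat \<Rightarrow> real \<Rightarrow> real \<Rightarrow> real" where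
  "step_error n B e = B\<^sup>2 / (2 * e)^3 + 8 * B^3 * (1 + 2 * real n^4) / e^4"

text \<open>Taylor expansion of the truncated reciprocal at \<open>V\<close>, integrated against an
  increment independent of \<open>G\<close>: terms linear in \<open>Z\<close> vanish, quadratic ones
  leave only the diagonal, and everything else is of order d sqrt d. This is Ito's formula for 1 / y
  over one cell, as an inequality.\<close>

lemma (in prob_space) one_step_estimate:
  fixes Z :: "'a \<Rightarrow> real^'n" and V b :: "'a \<Rightarrow> real" and c :: "'n \<Rightarrow> 'a \<Rightarrow> real"
  assumes sub: "subalgebra M G" and Z: "gaussian_vec M d Z" and d: "0 < d" "d \<le> 1"
    and ind: "indep_set (sets G) {Z -` B \<inter> space M | B. B \<in> sets borel}"
    and A: "A \<in> sets G" and V: "V \<in> borel_measurable G"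
    and b: "b \<in> borel_measurable G"
    and c: "\<And>j. c j \<in> borel_measurable G"
    and e: "0 < e" and B: "0 \<le> B"
    and V_ge: "\<And>\<omega>. \<omega> \<in> A \<Longrightarrow> 2 * e \<le> V \<omega>"
    and b_le: "\<And>\<omega>. \<omega> \<in> A \<Longrightarrow> \<bar>b \<omega>\<bar> \<le> B"
    and c_le: "\<And>\<omega> j. \<omega> \<in> A \<Longrightarrow> \<bar>c j \<omega>\<bar> \<le> B"
  shows "expectation (\<lambda>\<omega>. indicator A \<omega> / max (V \<omega> + (b \<omega> * d + (\<Sum>j\<in>UNIV. c j \<omega> * Z \<omega> $ j))) e)
    \<le> expectation (\<lambda>\<omega>. indicator A \<omega> * (1 / V \<omega> - b \<omega> * d / (V \<omega>)\<^sup>2 + (\<Sum>j\<in>UNIV. (c j \<omega>)\<^sup>2) * d / V \<omega>^3))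
      + step_error CARD('n) B e * (d * sqrt d)"
proof -
  define n where "n = real CARD('n)"
  \<comment> \<open>The coefficients of the expansion: \<open>G\<close>-measurable, and bounded
    because \<open>V\<close> stays above 2 e on \<open>A\<close>.\<close>
  define U where "U k x \<omega> = indicator A \<omega> * (x \<omega> / V \<omega>^k)" for k and x :: "'a \<Rightarrow> real" and \<omega>
  have Z_meas[measurable]: "Z \<in> borel_measurable M" by (rule gaussian_vec_measurable[OF Z])
  have toM: "f \<in> borel_measurable G \<Longrightarrow> f \<in> borel_measurable M" for f :: "'a \<Rightarrow> real"
    by (rule measurable_from_subalg[OF sub])
  note [measurable] = toM[OF V] toM[OF b] toM[OF c]
  have AM[measurable]: "A \<in> sets M" using A sub by (auto simp: subalgebra_def)
  have U_G: "U k x \<in> borel_measurable G" if "x \<in> borel_measurable G" for k x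
    unfolding U_def[abs_def]
    by (intro borel_measurable_times borel_measurable_divide borel_measurable_power borel_measurable_indicator A V that)
  have U_bd: "\<bar>U k x \<omega>\<bar> \<le> X / (2 * e)^k"
    if x: "\<And>\<omega>. \<omega> \<in> A \<Longrightarrow> \<bar>x \<omega>\<bar> \<le> X" and X: "0 \<le> X" for k x X \<omega>
  proof (cases "\<omega> \<in> A")
    case True
    have v: "2 * e \<le> V \<omega>" using V_ge[OF True] .
    then have v0: "0 < V \<omega>" using e by linarith
    have "\<bar>x \<omega>\<bar> / V \<omega>^k \<le> X / (2 * e)^k"
      using x[OF True] X e v by (intro frac_le power_mono) auto
    then show ?thesis using True v0 by (simp add: U_def abs_mult)
  next
    case False
    then show ?thesis using X e by (simp add: U_def)
  qed
  have U_int: "integrable M (U k x)"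
    if "x \<in> borel_measurable G" "\<And>\<omega>. \<omega> \<in> A \<Longrightarrow> \<bar>x \<omega>\<bar> \<le> X" "0 \<le> X" for k x X
    by (rule integrable_const_bound[of _ "X / (2 * e)^k"])
      (use U_bd[of x X k] that in \<open>auto intro: toM[OF U_G]\<close>)
  have U_mean: "has_bochner_integral M (\<lambda>\<omega>. U k x \<omega> * Z \<omega> $ j) 0"
    if "x \<in> borel_measurable G" "\<And>\<omega>. \<omega> \<in> A \<Longrightarrow> \<bar>x \<omega>\<bar> \<le> X" "0 \<le> X" for k x X j
    using indep_expectation_product[where g = "\<lambda>z. z $ j",
        OF sub Z_meas ind U_G[OF that(1), of k] U_bd[OF that(2,3)] _ gaussian_vec_mean[OF Z d(1)]]
    by simp
  have U_cov: "has_bochner_integral M (\<lambda>\<omega>. U k x \<omega> * (Z \<omega> $ i * Z \<omega> $ j)) (expectation (U k x) * (if i = j then d else 0))"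
    if "x \<in> borel_measurable G" "\<And>\<omega>. \<omega> \<in> A \<Longrightarrow> \<bar>x \<omega>\<bar> \<le> X" "0 \<le> X" for k x X i j
    by (rule indep_expectation_product[where g = "\<lambda>z. z $ i * z $ j",
        OF sub Z_meas ind U_G[OF that(1), of k] U_bd[OF that(2,3)] _ gaussian_vec_cov[OF Z d(1)]]) auto
  have cc: "\<bar>c j \<omega> * c k \<omega>\<bar> \<le> B * B" if "\<omega> \<in> A" for j k \<omega>
    unfolding abs_mult using c_le[OF that] B by (intro mult_mono) auto
  have bc: "\<bar>b \<omega> * c k \<omega>\<bar> \<le> B * B" if "\<omega> \<in> A" for k \<omega>
    unfolding abs_mult using c_le[OF that] b_le[OF that] B by (intro mult_mono) auto
  have bb: "\<bar>b \<omega> * b \<omega>\<bar> \<le> B * B" if "\<omega> \<in> A" for \<omega>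
    unfolding abs_mult using b_le[OF that] B by (intro mult_mono) auto

  have "0 \<le> B * B" by simp
  have I1: "has_bochner_integral M (\<lambda>\<omega>. \<Sum>j\<in>UNIV. U 2 (c j) \<omega> * Z \<omega> $ j) (\<Sum>j\<in>(UNIV::'n set). 0)"
    by (intro has_bochner_integral_sum U_mean[OF c c_le B])
  have I2: "has_bochner_integral M (\<lambda>\<omega>. \<Sum>j\<in>UNIV. U 3 (\<lambda>\<omega>. b \<omega> * c j \<omega>) \<omega> * Z \<omega> $ j) (\<Sum>j\<in>(UNIV::'n set). 0)"
    by (intro has_bochner_integral_sum U_mean[OF borel_measurable_times[OF b c] bc \<open>0 \<le> B * B\<close>])
  have I3: "has_bochner_integral M (\<lambda>\<omega>. \<Sum>j\<in>UNIV. \<Sum>k\<in>UNIV. U 3 (\<lambda>\<omega>. c j \<omega> * c k \<omega>) \<omega> * (Z \<omega> $ j * Z \<omega> $ k))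
    (\<Sum>j\<in>UNIV. \<Sum>k\<in>UNIV. expectation (U 3 (\<lambda>\<omega>. c j \<omega> * c k \<omega>)) * (if j = k then d else 0))"
    by (intro has_bochner_integral_sum U_cov[OF borel_measurable_times[OF c c] cc \<open>0 \<le> B * B\<close>])
  have I3': "(\<Sum>j\<in>UNIV. \<Sum>k\<in>UNIV. expectation (U 3 (\<lambda>\<omega>. c j \<omega> * c k \<omega>)) * (if j = k then d else 0))
      = (\<Sum>j\<in>UNIV. expectation (U 3 (\<lambda>\<omega>. c j \<omega> * c j \<omega>)) * d)"
    by (intro sum.cong refl) (simp add: if_distrib[of "\<lambda>z. _ * z"] cong: if_cong)
  have I4: "has_bochner_integral M (\<lambda>\<omega>. \<Sum>j\<in>UNIV. \<bar>Z \<omega> $ j\<bar>^3) (n * (2 * d * sqrt d * sqrt (2 / pi)))"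
    using has_bochner_integral_sum[of UNIV M "\<lambda>j \<omega>. \<bar>Z \<omega> $ j\<bar>^3" "\<lambda>j. 2 * d * sqrt d * sqrt (2 / pi)"]
      gaussian_vec_cube[OF Z d(1)] by (simp add: n_def)
  define L where "L = 8 * B^3 / e^4"
  have L: "0 \<le> L" using B e by (simp add: L_def)
  \<comment> \<open>The Taylor bound as a polynomial in \<open>Z\<close>, so that it can be
    integrated term by term.\<close>
  define R where "R \<omega> = U 1 (\<lambda>_. 1) \<omega> - d * U 2 b \<omega> - (\<Sum>j\<in>UNIV. U 2 (c j) \<omega> * Z \<omega> $ j)
      + d\<^sup>2 * U 3 (\<lambda>\<omega>. b \<omega> * b \<omega>) \<omega> + 2 * d * (\<Sum>j\<in>UNIV. U 3 (\<lambda>\<omega>. b \<omega> * c j \<omega>) \<omega> * Z \<omega> $ j)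
      + (\<Sum>j\<in>UNIV. \<Sum>k\<in>UNIV. U 3 (\<lambda>\<omega>. c j \<omega> * c k \<omega>) \<omega> * (Z \<omega> $ j * Z \<omega> $ k))
      + L * (d^3 + n^3 * (\<Sum>j\<in>UNIV. \<bar>Z \<omega> $ j\<bar>^3))" for \<omega>
  have U1: "integrable M (U 1 (\<lambda>_. 1))" by (rule U_int[of _ 1]) auto
  have Ub: "integrable M (U 2 b)" by (rule U_int[of _ B]) (use b B b_le in auto)
  have Ubb: "integrable M (U 3 (\<lambda>\<omega>. b \<omega> * b \<omega>))" by (rule U_int[of _ "B * B"]) (use borel_measurable_times[OF b b] B bb in auto)
  have Ucc: "integrable M (U 3 (\<lambda>\<omega>. c j \<omega> * c j \<omega>))" for j by (rule U_int[of _ "B * B"]) (use borel_measurable_times[OF c c] B cc[of _ j j] in auto)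
  have iR: "has_bochner_integral M R (expectation (U 1 (\<lambda>_. 1)) - d * expectation (U 2 b) - (\<Sum>j\<in>(UNIV::'n set). 0)
      + d\<^sup>2 * expectation (U 3 (\<lambda>\<omega>. b \<omega> * b \<omega>)) + 2 * d * (\<Sum>j\<in>(UNIV::'n set). 0)
      + (\<Sum>j\<in>UNIV. \<Sum>k\<in>UNIV. expectation (U 3 (\<lambda>\<omega>. c j \<omega> * c k \<omega>)) * (if j = k then d else 0))
      + L * (d^3 * measure M (space M) + n^3 * (n * (2 * d * sqrt d * sqrt (2 / pi)))))"
    unfolding R_def[abs_def]
    by (intro has_bochner_integral_add has_bochner_integral_diff has_bochner_integral_mult_right I1 I2 I3 I4
        has_bochner_integral_integrable U1 Ub Ubb)
      (use has_bochner_integral_integrable[OF integrable_const[of "d^3"]] in \<open>simp add: prob_space\<close>)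
  have le_R: "indicator A \<omega> / max (V \<omega> + (b \<omega> * d + (\<Sum>j\<in>UNIV. c j \<omega> * Z \<omega> $ j))) e \<le> R \<omega>" for \<omega>
  proof (cases "\<omega> \<in> A")
    \<comment> \<open>Off \<open>A\<close> every \<open>U\<close> vanishes and only the nonnegative
      cubic remainder is left in \<open>R\<close>.\<close>
    case False
    then show ?thesis using L d
      by (auto simp: R_def U_def n_def intro!: mult_nonneg_nonneg add_nonneg_nonneg sum_nonneg)
  next
    case True
    define s where "s = (\<Sum>j\<in>UNIV. c j \<omega> * Z \<omega> $ j)"
    define h where "h = b \<omega> * d + s"
    have abs_s: "\<bar>s\<bar> \<le> B * (\<Sum>j\<in>UNIV. \<bar>Z \<omega> $ j\<bar>)"
      unfolding s_def sum_distrib_left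
      by (rule order_trans[OF sum_abs]) (auto simp: abs_mult intro!: sum_mono mult_right_mono c_le True)
    have "\<bar>h\<bar> \<le> B * d + B * (\<Sum>j\<in>UNIV. \<bar>Z \<omega> $ j\<bar>)"
      unfolding h_def using abs_s b_le[OF True] d
      by (intro order_trans[OF abs_triangle_ineq] add_mono) (auto simp: abs_mult intro!: mult_right_mono)
    then have "\<bar>h\<bar> \<le> B * (d + (\<Sum>j\<in>UNIV. \<bar>Z \<omega> $ j\<bar>))" by (simp add: distrib_left)
    then have "\<bar>h\<bar>^3 \<le> (B * (d + (\<Sum>j\<in>UNIV. \<bar>Z \<omega> $ j\<bar>)))^3" by (intro power_mono) auto
    also have "\<dots> = B^3 * (d + (\<Sum>j\<in>UNIV. \<bar>Z \<omega> $ j\<bar>))^3" by (simp add: power_mult_distrib)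
    also have "\<dots> \<le> B^3 * (8 * (d^3 + (\<Sum>j\<in>UNIV. \<bar>Z \<omega> $ j\<bar>)^3))"
      using B d by (intro mult_left_mono add_cube_le) (auto intro: sum_nonneg)
    also have "\<dots> \<le> B^3 * (8 * (d^3 + n^3 * (\<Sum>j\<in>UNIV. \<bar>Z \<omega> $ j\<bar>^3)))"
      unfolding n_def using B by (intro mult_left_mono add_left_mono sum_cube_le) auto
    finally have "\<bar>h\<bar>^3 / e^4 \<le> B^3 * (8 * (d^3 + n^3 * (\<Sum>j\<in>UNIV. \<bar>Z \<omega> $ j\<bar>^3))) / e^4"
      using e by (intro divide_right_mono) auto
    also have "\<dots> = L * (d^3 + n^3 * (\<Sum>j\<in>UNIV. \<bar>Z \<omega> $ j\<bar>^3))" by (simp add: L_def)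
    finally have cube: "\<bar>h\<bar>^3 / e^4 \<le> L * (d^3 + n^3 * (\<Sum>j\<in>UNIV. \<bar>Z \<omega> $ j\<bar>^3))" .
    have s1: "(\<Sum>j\<in>UNIV. U 2 (c j) \<omega> * Z \<omega> $ j) = s / (V \<omega>)\<^sup>2"
      using True by (simp add: U_def s_def sum_divide_distrib)
    have s2: "(\<Sum>j\<in>UNIV. U 3 (\<lambda>\<omega>. b \<omega> * c j \<omega>) \<omega> * Z \<omega> $ j) = b \<omega> * s / V \<omega>^3"
      using True by (simp add: U_def s_def sum_divide_distrib sum_distrib_left ac_simps)
    have s3: "(\<Sum>j\<in>UNIV. \<Sum>k\<in>UNIV. U 3 (\<lambda>\<omega>. c j \<omega> * c k \<omega>) \<omega> * (Z \<omega> $ j * Z \<omega> $ k)) = s * s / V \<omega>^3"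
      using True unfolding U_def s_def sum_product by (simp add: sum_divide_distrib ac_simps)
    have "1 / V \<omega> - h / (V \<omega>)\<^sup>2 + h\<^sup>2 / V \<omega>^3 + L * (d^3 + n^3 * (\<Sum>j\<in>UNIV. \<bar>Z \<omega> $ j\<bar>^3)) = R \<omega>"
      unfolding R_def s1 s2 s3 using True
      by (simp add: U_def h_def add_divide_distrib diff_divide_distrib power2_eq_square algebra_simps)
    with inverse_max_taylor[OF e V_ge[OF True], of h] cube True show ?thesis
      by (simp add: h_def s_def)
  qed
  have "integrable M (\<lambda>\<omega>. indicator A \<omega> / max (V \<omega> + (b \<omega> * d + (\<Sum>j\<in>UNIV. c j \<omega> * Z \<omega> $ j))) e)"
  proof (rule integrable_const_bound)
    show "AE \<omega> in M. norm (indicator A \<omega> / max (V \<omega> + (b \<omega> * d + (\<Sum>j\<in>UNIV. c j \<omega> * Z \<omega> $ j))) e) \<le> 1 / e"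
      using e by (intro AE_I2) (auto simp: indicator_def intro!: frac_le)
  qed measurable
  then have "expectation (\<lambda>\<omega>. indicator A \<omega> / max (V \<omega> + (b \<omega> * d + (\<Sum>j\<in>UNIV. c j \<omega> * Z \<omega> $ j))) e) \<le> expectation R"
    using le_R by (intro integral_mono integrable.intros[OF iR]) auto
  also have "expectation R = expectation (U 1 (\<lambda>_. 1)) - d * expectation (U 2 b)
      + (\<Sum>j\<in>UNIV. expectation (U 3 (\<lambda>\<omega>. c j \<omega> * c j \<omega>)) * d)
      + (d\<^sup>2 * expectation (U 3 (\<lambda>\<omega>. b \<omega> * b \<omega>)) + L * (d^3 + n^3 * (n * (2 * d * sqrt d * sqrt (2 / pi)))))"
    unfolding has_bochner_integral_integral_eq[OF iR] I3' by (simp add: prob_space)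
  also have "expectation (U 1 (\<lambda>_. 1)) - d * expectation (U 2 b)
      + (\<Sum>j\<in>UNIV. expectation (U 3 (\<lambda>\<omega>. c j \<omega> * c j \<omega>)) * d) =
    expectation (\<lambda>\<omega>. indicator A \<omega> * (1 / V \<omega> - b \<omega> * d / (V \<omega>)\<^sup>2 + (\<Sum>j\<in>UNIV. (c j \<omega>)\<^sup>2) * d / V \<omega>^3))"
  proof -
    have "expectation (\<lambda>\<omega>. indicator A \<omega> * (1 / V \<omega> - b \<omega> * d / (V \<omega>)\<^sup>2 + (\<Sum>j\<in>UNIV. (c j \<omega>)\<^sup>2) * d / V \<omega>^3))
      = expectation (\<lambda>\<omega>. U 1 (\<lambda>_. 1) \<omega> - d * U 2 b \<omega> + (\<Sum>j\<in>UNIV. U 3 (\<lambda>\<omega>. c j \<omega> * c j \<omega>) \<omega> * d))"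
      by (intro Bochner_Integration.integral_cong refl)
        (auto simp: U_def indicator_def sum_divide_distrib sum_distrib_right power2_eq_square)
    then show ?thesis using U1 Ub Ucc by simp
  qed
  also have "d\<^sup>2 * expectation (U 3 (\<lambda>\<omega>. b \<omega> * b \<omega>)) + L * (d^3 + n^3 * (n * (2 * d * sqrt d * sqrt (2 / pi))))
    \<le> step_error CARD('n) B e * (d * sqrt d)"
  proof -
    \<comment> \<open>Here \<open>d \<le> 1\<close> enters: d^2 and d^3 are absorbed into d sqrt
      d.\<close>
    have "d \<le> sqrt d" using d by (intro real_le_rsqrt) (simp add: power2_eq_square mult_left_le)
    then have d2: "d\<^sup>2 \<le> d * sqrt d" using d by (simp add: power2_eq_square)
    have "d^3 \<le> d^2" using d by (intro power_decreasing) auto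
    then have d3: "d^3 \<le> d * sqrt d" using d2 by linarith
    have "expectation (U 3 (\<lambda>\<omega>. b \<omega> * b \<omega>)) \<le> expectation (\<lambda>_. B * B / (2 * e)^3)"
      by (intro integral_mono Ubb integrable_const order_trans[OF abs_ge_self U_bd[OF bb]]) (use B in auto)
    then have "expectation (U 3 (\<lambda>\<omega>. b \<omega> * b \<omega>)) \<le> B\<^sup>2 / (2 * e)^3"
      by (simp add: prob_space power2_eq_square)
    then have "d\<^sup>2 * expectation (U 3 (\<lambda>\<omega>. b \<omega> * b \<omega>)) \<le> d\<^sup>2 * (B\<^sup>2 / (2 * e)^3)"
      by (intro mult_left_mono) auto
    also have "\<dots> \<le> d * sqrt d * (B\<^sup>2 / (2 * e)^3)"
      using d2 e by (intro mult_right_mono) auto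
    finally have p1: "d\<^sup>2 * expectation (U 3 (\<lambda>\<omega>. b \<omega> * b \<omega>)) \<le> B\<^sup>2 / (2 * e)^3 * (d * sqrt d)"
      by (simp add: mult.commute)
    have "sqrt (2 / pi) \<le> 1" using pi_gt3 by simp
    then have "n^4 * (2 * (d * sqrt d)) * sqrt (2 / pi) \<le> n^4 * (2 * (d * sqrt d)) * 1"
      using d by (intro mult_left_mono) (auto simp: n_def)
    then have "d^3 + n^3 * (n * (2 * d * sqrt d * sqrt (2 / pi))) \<le> (1 + 2 * n^4) * (d * sqrt d)"
      using d3 by (simp add: algebra_simps power_numeral_reduce)
    then have "L * (d^3 + n^3 * (n * (2 * d * sqrt d * sqrt (2 / pi)))) \<le> L * ((1 + 2 * n^4) * (d * sqrt d))"
      using L by (intro mult_left_mono)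
    moreover have "step_error CARD('n) B e * (d * sqrt d)
        = B\<^sup>2 / (2 * e)^3 * (d * sqrt d) + L * ((1 + 2 * n^4) * (d * sqrt d))"
      by (simp add: step_error_def L_def n_def distrib_right)
    ultimately show ?thesis using p1 by linarith
  qed
  finally show ?thesis by simp
qed

section \<open>Grids adapted to simple processes\<close>

text \<open>Points are inserted into an equidistant grid one by one. A grid is an infinite sequence
  that stays at \<open>T\<close> once it gets there, so cells of length 0 occur and later arguments
  must allow for them.\<close>

lemma partition_avoiding:
  fixes T d :: real
  assumes "finite P" and T: "0 < T" and d: "0 < d"
  shows "\<exists>t m. t 0 = 0 \<and> t m = T \<and> (\<forall>l. t l \<le> t (Suc l) \<and> t (Suc l) - t l \<le> d \<and> t l \<le> T \<and>
    (\<forall>p\<in>P. \<not> (t l < p \<and> p < t (Suc l))))"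
  using \<open>finite P\<close>
proof induction
  case empty
  obtain m :: nat where "T / d \<le> real m" using real_arch_simple by blast
  then have m: "T \<le> real m * d" using d by (simp add: field_simps)
  show ?case
    by (intro exI[of _ "\<lambda>l. min (real l * d) T"] exI[of _ m] conjI allI)
      (use T d m in \<open>auto simp: min_def distrib_right\<close>)
next
  case (insert p P)
  then obtain t m where t: "t 0 = 0" "t m = T" "\<And>l. t l \<le> t (Suc l)" "\<And>l. t (Suc l) - t l \<le> d" "\<And>l. t l \<le> T"
    "\<And>l q. q \<in> P \<Longrightarrow> \<not> (t l < q \<and> q < t (Suc l))"
    by metis
  show ?case
  proof (cases "0 < p \<and> p < T")
    case False
    \<comment> \<open>The grid lies in [0, T], so it already avoids a point outside the open
      interval (0, T).\<close>
    have "0 \<le> t l" for l using lift_Suc_mono_le[of t 0 l, OF t(3)] t(1) by simp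
    then have "\<not> (t l < p \<and> p < t (Suc l))" for l
      using False t(5)[of "Suc l"] by (meson le_less_trans less_le_trans)
    then have "\<forall>q\<in>insert p P. \<not> (t l < q \<and> q < t (Suc l))" for l using t(6)[of _ l] by blast
    then show ?thesis using t(1-5) by blast
  next
    case True
    \<comment> \<open>The new grid follows \<open>t\<close> up to \<open>p\<close>, visits
      \<open>p\<close>, and then follows \<open>t\<close> with the index delayed by one; the maximum
      puts \<open>p\<close> at the index where \<open>t\<close> first reaches or passes it.\<close>
    define u where "u l = (if t l < p then t l else max p (t (l - 1)))" for l
    have 0: "u 0 = 0" using True t(1) by (simp add: u_def)
    have S: "u (Suc l) = (if t (Suc l) < p then t (Suc l) else max p (t l))" for l by (simp add: u_def)
    have ul: "u l \<le> t l" for l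
      using t(1) t(3)[of "l - 1"] True by (cases l) (auto simp: u_def)
    have lu: "t l \<le> u (Suc l)" for l using t(3)[of l] by (auto simp: S)
    \<comment> \<open>Every cell of \<open>u\<close> lies inside a cell of \<open>t\<close>, which
      preserves the mesh bound and the avoidance of the earlier points.\<close>
    have step: "u l = t l \<and> (u (Suc l) = t (Suc l) \<and> t (Suc l) < p \<or> u (Suc l) = p \<and> p \<le> t (Suc l))
      \<or> (\<exists>k. l = Suc k \<and> p \<le> t l \<and> u l = max p (t k) \<and> u (Suc l) = t l)" for l
    proof (cases "t l < p")
      case True
      then show ?thesis by (auto simp: u_def)
    next
      case False
      then obtain k where k: "l = Suc k" using t(1) True by (cases l) auto
      then show ?thesis using False t(3)[of l] by (auto simp: u_def)
    qed
    have "u l \<le> u (Suc l) \<and> u (Suc l) - u l \<le> d \<and> u l \<le> T \<and>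
      (\<forall>q\<in>insert p P. \<not> (u l < q \<and> q < u (Suc l)))" for l
    proof -
      have "u l \<le> T" using ul[of l] t(5)[of l] by simp
      moreover have "u l \<le> u (Suc l)" using ul[of l] lu[of l] by simp
      moreover have "u (Suc l) - u l \<le> d \<and> (\<forall>q\<in>insert p P. \<not> (u l < q \<and> q < u (Suc l)))"
        using step[of l]
      proof
        assume a: "u l = t l \<and> (u (Suc l) = t (Suc l) \<and> t (Suc l) < p \<or> u (Suc l) = p \<and> p \<le> t (Suc l))"
        then have "u (Suc l) \<le> t (Suc l)" "u (Suc l) \<le> p" by auto
        moreover have "\<not> (t l < q \<and> q < u (Suc l))" if "q \<in> P" for q
          using t(6)[OF that, of l] \<open>u (Suc l) \<le> t (Suc l)\<close> by linarith
        ultimately show ?thesis using a t(4)[of l] by auto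
      next
        assume "\<exists>k. l = Suc k \<and> p \<le> t l \<and> u l = max p (t k) \<and> u (Suc l) = t l"
        then obtain k where k: "l = Suc k" "p \<le> t l" "u l = max p (t k)" "u (Suc l) = t l" by blast
        have "\<not> (u l < q \<and> q < u (Suc l))" if "q \<in> P" for q
          using t(6)[OF that, of k] k by auto
        then show ?thesis using k t(4)[of k] by auto
      qed
      ultimately show ?thesis by blast
    qed
    moreover have "u (Suc m) = T" using True t(2) t(3)[of m] t(5)[of "Suc m"] by (auto simp: S)
    ultimately show ?thesis using 0 by blast
  qed
qed

text \<open>With no jump time strictly inside, (s, t] is either contained in or disjoint from each
  interval of constancy. Those intervals are open on the left, so the constant value is read off at
  the right end \<open>t\<close>.\<close>

lemma simple_integral_increment:
  assumes S: "simple_process M F (N, \<tau>, \<xi>)" and st: "s < t"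
    and avoid: "\<And>k. k \<le> N \<Longrightarrow> \<not> (s < \<tau> k \<and> \<tau> k < t)"
  shows "simple_integral B (N, \<tau>, \<xi>) t \<omega> - simple_integral B (N, \<tau>, \<xi>) s \<omega>
      = simple_value (N, \<tau>, \<xi>) t \<omega> * (B t \<omega> - B s \<omega>)"
    and "s < u \<Longrightarrow> u \<le> t \<Longrightarrow> simple_value (N, \<tau>, \<xi>) u \<omega> = simple_value (N, \<tau>, \<xi>) t \<omega>"
proof -
  have c: "\<tau> k \<le> \<tau> (Suc k) \<and> (\<tau> (Suc k) \<le> s \<or> t \<le> \<tau> k \<or> (\<tau> k \<le> s \<and> t \<le> \<tau> (Suc k)))" if "k < N" for k
    using S that avoid[of k] avoid[of "Suc k"] by fastforce
  have "\<xi> k \<omega> * (B (min t (\<tau> (Suc k))) \<omega> - B (min t (\<tau> k)) \<omega>) - \<xi> k \<omega> * (B (min s (\<tau> (Suc k))) \<omega> - B (min s (\<tau> k)) \<omega>)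
    = \<xi> k \<omega> * indicator {\<tau> k<..\<tau> (Suc k)} t * (B t \<omega> - B s \<omega>)" if "k < N" for k
  proof -
    consider "\<tau> (Suc k) \<le> s" "\<tau> k \<le> s" | "t \<le> \<tau> k" "t \<le> \<tau> (Suc k)" | "\<tau> k \<le> s" "t \<le> \<tau> (Suc k)"
      using c[of k] \<open>k < N\<close> by linarith
    then show ?thesis
      using st by cases (simp_all add: min_absorb1 min_absorb2 algebra_simps)
  qed
  then show "simple_integral B (N, \<tau>, \<xi>) t \<omega> - simple_integral B (N, \<tau>, \<xi>) s \<omega>
      = simple_value (N, \<tau>, \<xi>) t \<omega> * (B t \<omega> - B s \<omega>)"
    unfolding simple_integral.simps simple_value.simps sum_subtractf[symmetric] sum_distrib_right
    by (intro sum.cong) auto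
  show "simple_value (N, \<tau>, \<xi>) u \<omega> = simple_value (N, \<tau>, \<xi>) t \<omega>" if "s < u" "u \<le> t"
    unfolding simple_value.simps
  proof (intro sum.cong refl)
    fix k assume "k \<in> {..<N}"
    with c[of k] that st show "\<xi> k \<omega> * indicator {\<tau> k<..\<tau> (Suc k)} u = \<xi> k \<omega> * indicator {\<tau> k<..\<tau> (Suc k)} t"
      by (auto simp: indicator_def)
  qed
qed

lemma filtered_prob_space_measurable_mono:
  assumes "filtered_prob_space M F" "s \<le> t" "f \<in> measurable (F s) N"
  shows "f \<in> measurable (F t) N"
proof (rule measurable_from_subalg[OF _ assms(3)])
  show "subalgebra (F t) (F s)"
    using assms(1,2) unfolding filtered_prob_space_def filtration_def subalgebra_def by metis
qed

lemma filtered_prob_space_sets_mono: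
  assumes "filtered_prob_space M F" "s \<le> t" "A \<in> sets (F s)"
  shows "A \<in> sets (F t)"
  using assms unfolding filtered_prob_space_def filtration_def by blast

text \<open>The value is read at \<open>t\<close> but known at \<open>s\<close>: an interval of
  constancy containing \<open>t\<close> starts before \<open>t\<close>, hence by avoidance no later
  than \<open>s\<close>. This makes the integrand independent of the increment it
  multiplies.\<close>

lemma simple_value_measurable:
  assumes S: "simple_process M F (N, \<tau>, \<xi>)" and F: "filtered_prob_space M F" and st: "s < t"
    and avoid: "\<And>k. k \<le> N \<Longrightarrow> \<not> (s < \<tau> k \<and> \<tau> k < t)"
  shows "simple_value (N, \<tau>, \<xi>) t \<in> borel_measurable (F s)"
proof -
  have "(\<lambda>\<omega>. \<xi> k \<omega> * indicator {\<tau> k<..\<tau> (Suc k)} t) \<in> borel_measurable (F s)" if "k < N" for k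
  proof (cases "t \<in> {\<tau> k<..\<tau> (Suc k)}")
    case True
    then have "\<tau> k \<le> s" using avoid[of k] that by force
    moreover have "\<xi> k \<in> borel_measurable (F (\<tau> k))" using S that by simp
    ultimately have "\<xi> k \<in> borel_measurable (F s)"
      by (rule filtered_prob_space_measurable_mono[OF F])
    then show ?thesis by simp
  next
    case False then show ?thesis by simp
  qed
  then show ?thesis unfolding simple_value.simps[abs_def] by (intro borel_measurable_sum) auto
qed

lemma simple_value_bounded:
  assumes S: "simple_process M F (N, \<tau>, \<xi>)"
  shows "\<exists>C\<ge>0. \<forall>t. \<forall>\<omega>\<in>space M. \<bar>simple_value (N, \<tau>, \<xi>) t \<omega>\<bar> \<le> C"
proof -
  obtain C where C: "\<forall>k<N. \<forall>\<omega>\<in>space M. \<bar>\<xi> k \<omega>\<bar> \<le> C" using S unfolding simple_process.simps by blast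
  have "\<bar>simple_value (N, \<tau>, \<xi>) t \<omega>\<bar> \<le> real N * \<bar>C\<bar>" if "\<omega> \<in> space M" for t \<omega>
  proof -
    have "\<bar>\<xi> k \<omega> * indicator {\<tau> k<..\<tau> (Suc k)} t\<bar> \<le> \<bar>C\<bar>" if "k < N" for k
      using C that \<open>\<omega> \<in> space M\<close> abs_ge_self[of C] by (fastforce simp: indicator_def)
    then have "(\<Sum>k<N. \<bar>\<xi> k \<omega> * indicator {\<tau> k<..\<tau> (Suc k)} t\<bar>) \<le> (\<Sum>k<N. \<bar>C\<bar>)" by (intro sum_mono) auto
    then show ?thesis
      unfolding simple_value.simps by (intro order_trans[OF sum_abs]) simp
  qed
  then show ?thesis by (intro exI[of _ "real N * \<bar>C\<bar>"]) auto
qed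

lemma simple_integral_at_0: 
  assumes "simple_process M F (N, \<tau>, \<xi>)"
  shows "simple_integral B (N, \<tau>, \<xi>) 0 \<omega> = 0"
proof -
  have "0 \<le> \<tau> k" if "k \<le> N" for k
    using that assms by (induction k) (auto intro: order_trans)
  then show ?thesis by (auto simp: min_def intro!: sum.neutral)
qed

text \<open>Telescopes \<open>one_step_estimate\<close> over the grid: errors of order d^(3/2) per
  cell add up to sqrt d times the elapsed time. The sets \<open>A l\<close> switch single steps on
  and off; being known at \<open>t l\<close>, they may serve as conditioning events.\<close>

lemma (in prob_space) stopped_euler_bound:
  fixes W :: "real \<Rightarrow> 'a \<Rightarrow> real^'n" and V b :: "nat \<Rightarrow> 'a \<Rightarrow> real" and c :: "nat \<Rightarrow> 'n \<Rightarrow> 'a \<Rightarrow> real"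
  assumes F: "filtered_prob_space M F" and W: "wiener_process M F W"
    and t: "0 \<le> t 0" "\<And>l. t l \<le> t (Suc l)" "\<And>l. t (Suc l) - t l \<le> d" and d: "d \<le> 1"
    and A: "\<And>l. A l \<in> sets (F (t l))"
    and b: "\<And>l. b l \<in> borel_measurable (F (t l))"
    and c: "\<And>l j. c l j \<in> borel_measurable (F (t l))"
    and e: "0 < e" and B: "0 \<le> B"
    and V: "\<And>l \<omega>. V l \<omega> = x + (\<Sum>k<l. indicator (A k) \<omega> * (b k \<omega> * (t (Suc k) - t k)
        + (\<Sum>j\<in>UNIV. c k j \<omega> * (W (t (Suc k)) \<omega> - W (t k) \<omega>) $ j)))"
    and V_ge: "\<And>l \<omega>. \<omega> \<in> A l \<Longrightarrow> 2 * e \<le> V l \<omega>"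
    and b_le: "\<And>l \<omega>. \<omega> \<in> A l \<Longrightarrow> \<bar>b l \<omega>\<bar> \<le> B"
    and c_le: "\<And>l \<omega> j. \<omega> \<in> A l \<Longrightarrow> \<bar>c l j \<omega>\<bar> \<le> B"
  shows "expectation (\<lambda>\<omega>. 1 / max (V m \<omega>) e) \<le> 1 / max x e
    + expectation (\<lambda>\<omega>. \<Sum>l<m. indicator (A l) \<omega> * ((\<Sum>j\<in>UNIV. (c l j \<omega>)\<^sup>2) / V l \<omega>^3 - b l \<omega> / (V l \<omega>)\<^sup>2) * (t (Suc l) - t l))
    + step_error CARD('n) B e * sqrt d * (t m - t 0)"
proof -
  have mono: "t k \<le> t l" if "k \<le> l" for k l using lift_Suc_mono_le[of t k l, OF t(2)] that by blast
  have t0: "0 \<le> t l" for l using mono[of 0 l] t(1) by simp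
  have sub: "subalgebra M (F s)" for s using F by (simp add: filtered_prob_space_def)
  have Wm: "W (t k) \<in> borel_measurable (F (t l))" if "k \<le> l" for k l
  proof -
    have "W (t k) \<in> borel_measurable (F (t k))"
      using W t0[of k] unfolding wiener_process_def adapted_def by blast
    then show ?thesis by (rule filtered_prob_space_measurable_mono[OF F mono[OF that]])
  qed
  have V_meas: "V l \<in> borel_measurable (F (t l))" for l
  proof -
    have "(\<lambda>\<omega>. indicator (A k) \<omega> * (b k \<omega> * (t (Suc k) - t k)
        + (\<Sum>j\<in>UNIV. c k j \<omega> * (W (t (Suc k)) \<omega> - W (t k) \<omega>) $ j))) \<in> borel_measurable (F (t l))"
      if "k < l" for k
    proof -
      have up: "f \<in> borel_measurable (F (t l))" if "f \<in> borel_measurable (F (t k))" for f :: "'a \<Rightarrow> real"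
        using filtered_prob_space_measurable_mono[OF F _ that] mono[of k l] \<open>k < l\<close> by simp
      have "A k \<in> sets (F (t l))"
        using filtered_prob_space_sets_mono[OF F mono A[of k], of l] that by simp
      moreover have "(\<lambda>\<omega>. (W (t (Suc k)) \<omega> - W (t k) \<omega>) $ j) \<in> borel_measurable (F (t l))" for j
      proof -
        have "(\<lambda>\<omega>. W (t (Suc k)) \<omega> $ j - W (t k) \<omega> $ j) \<in> borel_measurable (F (t l))"
          using that by (intro borel_measurable_diff borel_measurable_vec_component Wm) auto
        then show ?thesis by simp
      qed
      ultimately show ?thesis
        by (intro borel_measurable_times borel_measurable_add borel_measurable_sum
            borel_measurable_indicator borel_measurable_const up[OF b] up[OF c])
    qed
    then show ?thesis unfolding V[abs_def] by (intro borel_measurable_add borel_measurable_sum) auto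
  qed
  have toM: "f \<in> borel_measurable (F s) \<Longrightarrow> f \<in> borel_measurable M" for f :: "'a \<Rightarrow> real" and s
    by (rule measurable_from_subalg[OF sub])
  have AM[measurable]: "A l \<in> sets M" for l using A sub[of "t l"] by (auto simp: subalgebra_def)
  note [measurable] = toM[OF V_meas] toM[OF b] toM[OF c]
  have phi_int: "integrable M (\<lambda>\<omega>. 1 / max (V l \<omega>) e)" for l
    by (rule integrable_const_bound[of _ "1 / e"]) (use e in \<open>auto intro!: frac_le AE_I2\<close>)
  define g where "g l \<omega> = indicator (A l) \<omega> * ((\<Sum>j\<in>UNIV. (c l j \<omega>)\<^sup>2) / V l \<omega>^3 - b l \<omega> / (V l \<omega>)\<^sup>2) * (t (Suc l) - t l)" for l \<omega>
  have g_int: "integrable M (g l)" for l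
  proof (rule integrable_const_bound)
    show "g l \<in> borel_measurable M" unfolding g_def[abs_def] by measurable
    show "AE \<omega> in M. norm (g l \<omega>) \<le> (real CARD('n) * B\<^sup>2 / (2 * e)^3 + B / (2 * e)\<^sup>2) * (t (Suc l) - t l)"
    proof (intro AE_I2)
      fix \<omega>
      show "norm (g l \<omega>) \<le> (real CARD('n) * B\<^sup>2 / (2 * e)^3 + B / (2 * e)\<^sup>2) * (t (Suc l) - t l)"
      proof (cases "\<omega> \<in> A l")
        case True
        have v: "2 * e \<le> V l \<omega>" by (rule V_ge[OF True])
        have "(\<Sum>j\<in>UNIV. (c l j \<omega>)\<^sup>2) \<le> real CARD('n) * B\<^sup>2"
          using sum_bounded_above[of UNIV "\<lambda>j. (c l j \<omega>)\<^sup>2" "B\<^sup>2"] c_le[OF True]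
          by (simp add: abs_le_square_iff[symmetric] B)
        then have 1: "(\<Sum>j\<in>UNIV. (c l j \<omega>)\<^sup>2) / V l \<omega>^3 \<le> real CARD('n) * B\<^sup>2 / (2 * e)^3"
          using v e by (intro frac_le power_mono) (auto intro: sum_nonneg)
        have 2: "\<bar>b l \<omega>\<bar> / (V l \<omega>)\<^sup>2 \<le> B / (2 * e)\<^sup>2"
          using v e b_le[OF True] by (intro frac_le power_mono) auto
        have "0 \<le> (\<Sum>j\<in>UNIV. (c l j \<omega>)\<^sup>2) / V l \<omega>^3"
          using v e by (intro divide_nonneg_nonneg sum_nonneg) auto
        moreover have "\<bar>b l \<omega> / (V l \<omega>)\<^sup>2\<bar> = \<bar>b l \<omega>\<bar> / (V l \<omega>)\<^sup>2" by simp
        ultimately have "\<bar>(\<Sum>j\<in>UNIV. (c l j \<omega>)\<^sup>2) / V l \<omega>^3 - b l \<omega> / (V l \<omega>)\<^sup>2\<bar> \<le> real CARD('n) * B\<^sup>2 / (2 * e)^3 + B / (2 * e)\<^sup>2"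
          using 1 2 by linarith
        then show ?thesis using True t(2)[of l]
          by (simp add: g_def abs_mult mult_right_mono)
      next
        case False
        then show ?thesis using t(2)[of l] B e by (simp add: g_def)
      qed
    qed
  qed
  have step: "expectation (\<lambda>\<omega>. 1 / max (V (Suc l) \<omega>) e) \<le> expectation (\<lambda>\<omega>. 1 / max (V l \<omega>) e)
      + expectation (g l) + step_error CARD('n) B e * sqrt d * (t (Suc l) - t l)" for l
  \<comment> \<open>A cell of length 0 carries no Gaussian density and is settled separately:
    nothing moves on it.\<close>
  proof (cases "t (Suc l) = t l")
    case True
    then have "V (Suc l) = V l" by (auto simp: V)
    moreover have "g l = (\<lambda>_. 0)" using True by (auto simp: g_def)
    ultimately show ?thesis using True by simp
  next
    case False
    define \<Delta> where "\<Delta> = t (Suc l) - t l"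
    have \<Delta>: "0 < \<Delta>" "\<Delta> \<le> d" "\<Delta> \<le> 1" using False t(2,3)[of l] d by (auto simp: \<Delta>_def)
    define Z where "Z \<omega> = W (t (Suc l)) \<omega> - W (t l) \<omega>" for \<omega>
    have Z: "gaussian_vec M \<Delta> Z"
      and ind: "indep_set (sets (F (t l))) {Z -` B \<inter> space M | B. B \<in> sets borel}"
      using W t0[of l] \<Delta> unfolding wiener_process_def gaussian_vec_def \<Delta>_def Z_def[abs_def] by auto
    define P where "P \<omega> = b l \<omega> * \<Delta> + (\<Sum>j\<in>UNIV. c l j \<omega> * Z \<omega> $ j)" for \<omega>
    have Z_m[measurable]: "Z \<in> borel_measurable M" by (rule gaussian_vec_measurable[OF Z])
    have "V (Suc l) \<omega> = V l \<omega> + indicator (A l) \<omega> * P \<omega>" for \<omega>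
      by (simp add: V P_def Z_def \<Delta>_def)
    \<comment> \<open>Outside \<open>A l\<close> the reciprocal is unchanged; inside, one Euler step
      is made.\<close>
    then have eq: "1 / max (V (Suc l) \<omega>) e = (1 - indicator (A l) \<omega>) / max (V l \<omega>) e
       + indicator (A l) \<omega> / max (V l \<omega> + P \<omega>) e" for \<omega>
      by (simp add: indicator_def)
    have i1: "integrable M (\<lambda>\<omega>. (1 - indicator (A l) \<omega>) / max (V l \<omega>) e)"
      by (rule integrable_const_bound[of _ "1 / e"])
        (use e in \<open>auto simp: indicator_def intro!: frac_le AE_I2\<close>)
    have i2: "integrable M (\<lambda>\<omega>. indicator (A l) \<omega> / max (V l \<omega> + P \<omega>) e)"
      unfolding P_def by (rule integrable_const_bound[of _ "1 / e"])
        (use e in \<open>auto simp: indicator_def intro!: frac_le AE_I2\<close>)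
    have 0: "indicator (A l) \<omega> * (1 / V l \<omega> - b l \<omega> * \<Delta> / (V l \<omega>)\<^sup>2 + (\<Sum>j\<in>UNIV. (c l j \<omega>)\<^sup>2) * \<Delta> / V l \<omega>^3)
      = (1 / max (V l \<omega>) e - (1 - indicator (A l) \<omega>) / max (V l \<omega>) e) + g l \<omega>" for \<omega>
    proof (cases "\<omega> \<in> A l")
      case True
      then have "max (V l \<omega>) e = V l \<omega>" using V_ge[OF True] e by simp
      then show ?thesis using True by (simp add: g_def \<Delta>_def[symmetric] left_diff_distrib)
    qed (simp add: g_def)
    have "expectation (\<lambda>\<omega>. indicator (A l) \<omega> / max (V l \<omega> + P \<omega>) e)
      \<le> expectation (\<lambda>\<omega>. (1 / max (V l \<omega>) e - (1 - indicator (A l) \<omega>) / max (V l \<omega>) e) + g l \<omega>)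
       + step_error CARD('n) B e * (\<Delta> * sqrt \<Delta>)"
      using one_step_estimate[where G = "F (t l)" and A = "A l" and V = "V l" and b = "b l" and c = "c l",
          OF sub Z \<Delta>(1,3) ind A V_meas b c e B V_ge b_le c_le]
      unfolding 0 P_def by simp
    moreover have "step_error CARD('n) B e * (\<Delta> * sqrt \<Delta>) \<le> step_error CARD('n) B e * (\<Delta> * sqrt d)"
      using \<Delta> B e by (intro mult_left_mono) (auto simp: step_error_def)
    ultimately show ?thesis
      unfolding eq using i1 i2 phi_int[of l] g_int[of l] by (simp add: \<Delta>_def ac_simps)
  qed
  show ?thesis unfolding g_def[symmetric]
  proof (induction m)
    case 0
    then show ?case by (simp add: V prob_space)
  next
    case (Suc m)
    have "expectation (\<lambda>\<omega>. \<Sum>l<Suc m. g l \<omega>) = expectation (\<lambda>\<omega>. \<Sum>l<m. g l \<omega>) + expectation (g m)"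
      using g_int by simp
    moreover have "step_error CARD('n) B e * sqrt d * (t (Suc m) - t 0) =
      step_error CARD('n) B e * sqrt d * (t m - t 0) + step_error CARD('n) B e * sqrt d * (t (Suc m) - t m)"
      by (simp add: algebra_simps)
    ultimately show ?case using Suc step[of m] by linarith
  qed
qed

section \<open>The stopped Euler scheme of a solution\<close>

lemma open_pos_orthant: "open (pos_orthant :: (real^'n) set)"
proof -
  have "(pos_orthant :: (real^'n) set) = (\<Inter>j\<in>UNIV. {y. 0 < y $ j})" by (auto simp: pos_orthant_def)
  moreover have "open (\<Inter>j\<in>UNIV. {y::real^'n. 0 < y $ j})"
    by (intro open_INT ballI open_Collect_less continuous_intros) auto
  ultimately show ?thesis by simp
qed

text \<open>\<open>B\<close> bounds the coefficients on the ball of radius \<open>R\<close>,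
  \<open>C\<close> also the simple integrands; \<open>c k j\<close> is meant as the value of the
  \<open>j\<close>-th simple process on cell \<open>k\<close>. \<open>d\<close> bounds the mesh,
  \<epsilon> is the level to be reached, and \<delta> is the tolerance between Euler sums and
  solution, at most \<epsilon> / 2 so that the denominators stay away from 0.\<close>

locale euler_scheme = prob_space M for M :: "'a measure" +
  fixes F :: "real \<Rightarrow> 'a measure" and W X :: "real \<Rightarrow> 'a \<Rightarrow> real^'n"
    and \<mu> :: "real^'n \<Rightarrow> real^'n" and \<sigma> :: "real^'n \<Rightarrow> real^'n^'n" and i :: 'n
    and t :: "nat \<Rightarrow> real" and d :: real and c :: "nat \<Rightarrow> 'n \<Rightarrow> 'a \<Rightarrow> real"
    and x R B C \<epsilon> \<delta> :: real
  assumes F: "filtered_prob_space M F" and W: "wiener_process M F W"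
    and t: "t 0 = 0" "\<And>l. t l \<le> t (Suc l)" "\<And>l. t (Suc l) - t l \<le> d" and d: "d \<le> 1"
    and X: "adapted F X"
    and \<mu>: "continuous_on UNIV \<mu>" and \<sigma>: "continuous_on UNIV \<sigma>"
    and drift_dominates: "\<And>y. y \<in> pos_orthant \<Longrightarrow> (\<Sum>j\<in>UNIV. (\<sigma> y $ i $ j)\<^sup>2) \<le> \<mu> y $ i * y $ i"
    and \<mu>_bound: "\<And>y. norm y \<le> R \<Longrightarrow> \<bar>\<mu> y $ i\<bar> \<le> B"
    and \<sigma>_bound: "\<And>y j. norm y \<le> R \<Longrightarrow> \<bar>\<sigma> y $ i $ j\<bar> \<le> B"
    and c: "\<And>k j. c k j \<in> borel_measurable (F (t k))"
    and c_bound: "\<And>k j \<omega>. \<omega> \<in> space M \<Longrightarrow> \<bar>c k j \<omega>\<bar> \<le> C"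
    and B: "0 \<le> B" "B \<le> C" and \<epsilon>: "0 < \<epsilon>" "\<epsilon> < x" and \<delta>: "0 < \<delta>" "\<delta> \<le> \<epsilon> / 2"
begin

definition incr :: "nat \<Rightarrow> 'a \<Rightarrow> real" where
  "incr k \<omega> = \<mu> (X (t k) \<omega>) $ i * (t (Suc k) - t k)
     + (\<Sum>j\<in>UNIV. c k j \<omega> * (W (t (Suc k)) \<omega> - W (t k) \<omega>) $ j)"

definition Z :: "nat \<Rightarrow> 'a \<Rightarrow> real" where
  "Z l \<omega> = x + (\<Sum>k<l. incr k \<omega>)"

text \<open>The contribution of one cell to the squared L2 distance between the simple integrands
  and row \<open>i\<close> of \<sigma> along the path, with \<sigma> sampled at the left
  end.\<close>

definition err :: "nat \<Rightarrow> 'a \<Rightarrow> real" where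
  "err k \<omega> = (\<Sum>j\<in>UNIV. (c k j \<omega> - \<sigma> (X (t k) \<omega>) $ i $ j)\<^sup>2) * (t (Suc k) - t k)"

text \<open>The sum of \<open>err\<close> includes cell \<open>k\<close> itself. This is admissible
  because \<open>c k j\<close> is known at \<open>t k\<close>, and it keeps the accumulated error of
  all steps actually made below \<delta>.\<close>

definition near :: "nat \<Rightarrow> 'a \<Rightarrow> bool" where
  "near k \<omega> \<longleftrightarrow> X (t k) \<omega> \<in> pos_orthant \<and> \<epsilon> < X (t k) \<omega> $ i \<and> norm (X (t k) \<omega>) \<le> R
     \<and> \<bar>Z k \<omega> - X (t k) \<omega> $ i\<bar> \<le> \<delta> \<and> (\<Sum>l\<le>k. err l \<omega>) \<le> \<delta>"

definition alive :: "nat \<Rightarrow> 'a set" where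
  "alive l = {\<omega> \<in> space M. \<forall>k\<le>l. near k \<omega>}"

definition V :: "nat \<Rightarrow> 'a \<Rightarrow> real" where
  "V l \<omega> = x + (\<Sum>k<l. indicator (alive k) \<omega> * incr k \<omega>)"

lemma t_mono: "k \<le> l \<Longrightarrow> t k \<le> t l"
  using lift_Suc_mono_le[of t k l, OF t(2)] by blast

lemma t_nonneg: "0 \<le> t l"
  using t_mono[of 0 l] t(1) by simp

lemma X_measurable: "k \<le> l \<Longrightarrow> X (t k) \<in> borel_measurable (F (t l))"
proof -
  assume "k \<le> l"
  have "X (t k) \<in> borel_measurable (F (t k))" using X t_nonneg[of k] unfolding adapted_def by blast
  then show ?thesis by (rule filtered_prob_space_measurable_mono[OF F t_mono[OF \<open>k \<le> l\<close>]])
qed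

lemma W_measurable: "k \<le> l \<Longrightarrow> W (t k) \<in> borel_measurable (F (t l))"
proof -
  assume "k \<le> l"
  have "W (t k) \<in> borel_measurable (F (t k))"
    using W t_nonneg[of k] unfolding wiener_process_def adapted_def by blast
  then show ?thesis by (rule filtered_prob_space_measurable_mono[OF F t_mono[OF \<open>k \<le> l\<close>]])
qed

lemma c_measurable: "k \<le> l \<Longrightarrow> c k j \<in> borel_measurable (F (t l))"
  by (rule filtered_prob_space_measurable_mono[OF F t_mono c])

lemma drift_measurable: "k \<le> l \<Longrightarrow> (\<lambda>\<omega>. \<mu> (X (t k) \<omega>) $ i) \<in> borel_measurable (F (t l))"
  by (intro borel_measurable_vec_component measurable_compose[OF X_measurable borel_measurable_continuous_onI[OF \<mu>]])

lemma sigma_measurable: "k \<le> l \<Longrightarrow> (\<lambda>\<omega>. \<sigma> (X (t k) \<omega>) $ i $ j) \<in> borel_measurable (F (t l))"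
  by (rule measurable_compose[OF X_measurable borel_measurable_continuous_onI], assumption)
    (intro continuous_intros \<sigma>)

lemma incr_measurable:
  assumes "k < l" shows "incr k \<in> borel_measurable (F (t l))"
proof -
  have "(\<lambda>\<omega>. W (t (Suc k)) \<omega> $ j - W (t k) \<omega> $ j) \<in> borel_measurable (F (t l))" for j
    using assms by (intro borel_measurable_diff borel_measurable_vec_component W_measurable) auto
  then show ?thesis
    unfolding incr_def[abs_def] vector_minus_component
    using assms by (intro borel_measurable_add borel_measurable_times borel_measurable_sum
        drift_measurable c_measurable borel_measurable_const) auto
qed

lemma Z_measurable: "Z l \<in> borel_measurable (F (t l))"
  unfolding Z_def[abs_def]
  by (intro borel_measurable_add borel_measurable_sum borel_measurable_const incr_measurable) auto

lemma err_measurable: "k \<le> l \<Longrightarrow> err k \<in> borel_measurable (F (t l))"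
  unfolding err_def[abs_def]
  by (intro borel_measurable_times borel_measurable_sum borel_measurable_power borel_measurable_diff
      c_measurable sigma_measurable borel_measurable_const)

lemma space_F: "space (F s) = space M"
  using F by (simp add: filtered_prob_space_def subalgebra_def)

lemma alive_sets: "alive l \<in> sets (F (t l))"
proof -
  have near: "{\<omega> \<in> space (F (t k)). near k \<omega>} \<in> sets (F (t k))" for k
  proof -
    note [measurable] = X_measurable[of k k, OF order_refl] Z_measurable[of k]
      borel_measurable_sum[OF err_measurable, of "{..k}" "\<lambda>k. k" k]
    have 1: "{\<omega> \<in> space (F (t k)). X (t k) \<omega> \<in> pos_orthant} \<in> sets (F (t k))"
      using measurable_sets[OF X_measurable[of k k, OF order_refl] borel_open[OF open_pos_orthant]]
      by (simp add: vimage_def Int_def conj_commute)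
    have 2: "{\<omega> \<in> space (F (t k)). \<epsilon> < X (t k) \<omega> $ i} \<in> sets (F (t k))"
      "{\<omega> \<in> space (F (t k)). norm (X (t k) \<omega>) \<le> R} \<in> sets (F (t k))"
      "{\<omega> \<in> space (F (t k)). \<bar>Z k \<omega> - X (t k) \<omega> $ i\<bar> \<le> \<delta>} \<in> sets (F (t k))"
      "{\<omega> \<in> space (F (t k)). (\<Sum>l\<le>k. err l \<omega>) \<le> \<delta>} \<in> sets (F (t k))"
      by measurable
    show ?thesis
      unfolding near_def by (intro sets.sets_Collect_conj 1 2)
  qed
  have "{\<omega> \<in> space (F (t l)). \<forall>k\<in>{..l}. near k \<omega>} \<in> sets (F (t l))"
  proof (rule sets.sets_Collect_finite_All)
    fix k assume "k \<in> {..l}"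
    then show "{\<omega> \<in> space (F (t l)). near k \<omega>} \<in> sets (F (t l))"
      using filtered_prob_space_sets_mono[OF F t_mono near, of k l] by (simp add: space_F)
  qed auto
  moreover have "{\<omega> \<in> space (F (t l)). \<forall>k\<in>{..l}. near k \<omega>} = alive l"
    unfolding alive_def space_F by auto
  ultimately show ?thesis by (rule subst[rotated])
qed

lemma alive_mono: "k \<le> l \<Longrightarrow> alive l \<subseteq> alive k"
  unfolding alive_def by auto

lemma V_eq_Z: 
  assumes "\<And>k. k < l \<Longrightarrow> \<omega> \<in> alive k" shows "V l \<omega> = Z l \<omega>"
  using assms by (simp add: V_def Z_def)

lemma V_stopped:
  assumes "\<And>k. k < l \<Longrightarrow> \<omega> \<in> alive k" "\<omega> \<notin> alive l" "l \<le> m"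
  shows "V m \<omega> = Z l \<omega>"
proof -
  have "\<omega> \<notin> alive k" if "l \<le> k" for k using alive_mono[OF that] assms(2) by auto
  then have "(\<Sum>k<m. indicator (alive k) \<omega> * incr k \<omega>) = (\<Sum>k<l. indicator (alive k) \<omega> * incr k \<omega>)"
    using \<open>l \<le> m\<close> by (intro sum.mono_neutral_right) auto
  then show ?thesis using V_eq_Z[of l \<omega>] assms(1) by (simp add: V_def)
qed

text \<open>\<epsilon> / 4 is the truncation level passed to the Taylor estimate; half of \<epsilon>
  is lost to the tolerance \<delta>.\<close>

lemma alive_V:
  assumes "\<omega> \<in> alive l"
  shows "\<bar>V l \<omega> - X (t l) \<omega> $ i\<bar> \<le> \<delta>" "2 * (\<epsilon> / 4) \<le> V l \<omega>"
proof -
  have V: "V l \<omega> = Z l \<omega>" using alive_mono[of _ l] assms by (intro V_eq_Z) (meson less_imp_le subsetD)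
  have n: "near l \<omega>" using assms by (simp add: alive_def)
  show "\<bar>V l \<omega> - X (t l) \<omega> $ i\<bar> \<le> \<delta>" using n V by (simp add: near_def)
  then show "2 * (\<epsilon> / 4) \<le> V l \<omega>" using n \<delta> unfolding near_def by linarith
qed

lemma err_nonneg: "0 \<le> err k \<omega>"
  unfolding err_def using t(2)[of k] by (intro mult_nonneg_nonneg sum_nonneg) auto

text \<open>The sum grows only in steps with \<open>alive l\<close>, and at such an \<open>l\<close>
  the condition in \<open>near\<close> bounds the whole sum.\<close>

lemma sum_alive_err: "(\<Sum>k<l. indicator (alive k) \<omega> * err k \<omega>) \<le> \<delta>"
proof (induction l)
  case 0
  then show ?case using \<delta> by simp
next
  case (Suc l)
  show ?case
  proof (cases "\<omega> \<in> alive l")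
    case True
    have "(\<Sum>k<Suc l. indicator (alive k) \<omega> * err k \<omega>) \<le> (\<Sum>k<Suc l. err k \<omega>)"
      using err_nonneg by (intro sum_mono) (auto simp: indicator_def)
    also have "\<dots> = (\<Sum>k\<le>l. err k \<omega>)" by (simp add: lessThan_Suc_atMost)
    also have "\<dots> \<le> \<delta>" using True by (simp add: alive_def near_def)
    finally show ?thesis .
  qed (use Suc in simp)
qed

text \<open>The left side is the drift of 1 / y for the scheme, that is (sum of c^2 - b V) / V^3. It
  would be nonpositive with \<sigma> for \<open>c\<close> and the solution for \<open>V\<close>.
  Exchanging \<open>V\<close> costs B \<delta>; exchanging \<open>c\<close> costs, by Young's
  inequality with parameter \<theta>, a small multiple of \<sigma>^2 and a large multiple of
  \<open>err\<close>.\<close>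

lemma alive_drift:
  assumes \<omega>: "\<omega> \<in> alive l" and \<theta>: "0 < \<theta>"
  shows "((\<Sum>j\<in>UNIV. (c l j \<omega>)\<^sup>2) / V l \<omega>^3 - \<mu> (X (t l) \<omega>) $ i / (V l \<omega>)\<^sup>2) * (t (Suc l) - t l)
    \<le> ((B * \<delta> + \<theta> * (real CARD('n) * B\<^sup>2)) * (t (Suc l) - t l) + (1 + 1 / \<theta>) * err l \<omega>) / (\<epsilon> / 2)^3"
proof -
  define y where "y = X (t l) \<omega>"
  define b where "b = \<mu> y $ i"
  define v where "v = V l \<omega>"
  define h where "h j = \<sigma> y $ i $ j" for j
  define D where "D = (\<Sum>j\<in>UNIV. (c l j \<omega> - h j)\<^sup>2)"
  have y: "y \<in> pos_orthant" "norm y \<le> R" using \<omega> by (auto simp: alive_def near_def y_def)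
  have v: "\<bar>v - y $ i\<bar> \<le> \<delta>" "\<epsilon> / 2 \<le> v" using alive_V[OF \<omega>] by (auto simp: v_def y_def)
  have v0: "0 < v" using v \<epsilon> by linarith
  have young: "(c l j \<omega>)\<^sup>2 \<le> (1 + \<theta>) * (h j)\<^sup>2 + (1 + 1 / \<theta>) * (c l j \<omega> - h j)\<^sup>2" for j
  proof -
    define k where "k = c l j \<omega> - h j"
    \<comment> \<open>Young's inequality for the cross term 2 h k, from a completed square.\<close>
    have "0 \<le> (\<theta> * h j - k)\<^sup>2 / \<theta>" using \<theta> by simp
    also have "\<dots> = \<theta> * (h j)\<^sup>2 + (1 / \<theta>) * k\<^sup>2 - 2 * h j * k"
      using \<theta> by (simp add: field_simps power2_eq_square)
    finally have "(h j + k)\<^sup>2 \<le> (1 + \<theta>) * (h j)\<^sup>2 + (1 + 1 / \<theta>) * k\<^sup>2"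
      by (simp add: power2_eq_square algebra_simps)
    then show ?thesis by (simp add: k_def)
  qed
  have "(\<Sum>j\<in>UNIV. (h j)\<^sup>2) \<le> real CARD('n) * B\<^sup>2"
    using sum_bounded_above[of UNIV "\<lambda>j. (h j)\<^sup>2" "B\<^sup>2"] \<sigma>_bound[OF y(2)] B(1)
    by (simp add: abs_le_square_iff[symmetric] h_def)
  then have h2: "\<theta> * (\<Sum>j\<in>UNIV. (h j)\<^sup>2) \<le> \<theta> * (real CARD('n) * B\<^sup>2)" using \<theta> by (intro mult_left_mono) auto
  have b: "\<bar>b\<bar> \<le> B" using \<mu>_bound[OF y(2)] by (simp add: b_def)
  have "b * y $ i - b * v \<le> \<bar>b\<bar> * \<bar>v - y $ i\<bar>"
    by (metis abs_ge_self abs_minus_commute abs_mult right_diff_distrib)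
  also have "\<dots> \<le> B * \<delta>" using b v B by (intro mult_mono) auto
  finally have by_le: "(\<Sum>j\<in>UNIV. (h j)\<^sup>2) \<le> b * v + B * \<delta>"
    using drift_dominates[OF y(1)] by (simp add: b_def h_def)
  have "(\<Sum>j\<in>UNIV. (c l j \<omega>)\<^sup>2) \<le> (\<Sum>j\<in>UNIV. (1 + \<theta>) * (h j)\<^sup>2 + (1 + 1 / \<theta>) * (c l j \<omega> - h j)\<^sup>2)"
    by (intro sum_mono young)
  also have "\<dots> = (\<Sum>j\<in>UNIV. (h j)\<^sup>2) + \<theta> * (\<Sum>j\<in>UNIV. (h j)\<^sup>2) + (1 + 1 / \<theta>) * D"
    by (simp add: D_def sum.distrib sum_distrib_left distrib_right)
  also have "\<dots> \<le> b * v + B * \<delta> + \<theta> * (real CARD('n) * B\<^sup>2) + (1 + 1 / \<theta>) * D"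
    using by_le h2 by linarith
  finally have E: "(\<Sum>j\<in>UNIV. (c l j \<omega>)\<^sup>2) - b * v \<le> B * \<delta> + \<theta> * (real CARD('n) * B\<^sup>2) + (1 + 1 / \<theta>) * D" (is "_ \<le> ?E")
    by linarith
  have D0: "0 \<le> D" unfolding D_def by (intro sum_nonneg) auto
  \<comment> \<open>The sign is needed below: only a nonnegative numerator lets \<open>v\<close> be
    replaced by its lower bound in the denominator.\<close>
  have "0 \<le> ?E" using D0 \<theta> B \<delta> by (intro add_nonneg_nonneg mult_nonneg_nonneg) auto
  have "(\<Sum>j\<in>UNIV. (c l j \<omega>)\<^sup>2) / v^3 - b / v\<^sup>2 = ((\<Sum>j\<in>UNIV. (c l j \<omega>)\<^sup>2) - b * v) / v^3"
    using v0 by (simp add: diff_divide_distrib power2_eq_square power3_eq_cube)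
  also have "\<dots> \<le> ?E / v^3" using E v0 by (intro divide_right_mono) auto
  also have "\<dots> \<le> ?E / (\<epsilon> / 2)^3"
    using \<open>0 \<le> ?E\<close> v \<epsilon> by (intro frac_le power_mono) auto
  finally have "((\<Sum>j\<in>UNIV. (c l j \<omega>)\<^sup>2) / v^3 - b / v\<^sup>2) * (t (Suc l) - t l) \<le> ?E / (\<epsilon> / 2)^3 * (t (Suc l) - t l)"
    using t(2)[of l] by (intro mult_right_mono) auto
  also have "\<dots> = ((B * \<delta> + \<theta> * (real CARD('n) * B\<^sup>2)) * (t (Suc l) - t l) + (1 + 1 / \<theta>) * (D * (t (Suc l) - t l))) / (\<epsilon> / 2)^3"
    by (simp add: distrib_right mult.assoc)
  finally show ?thesis
    by (simp add: v_def b_def y_def h_def D_def err_def)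
qed

text \<open>Markov's inequality for the reciprocal at 1 / (2 \<epsilon>). The level is 2 \<epsilon>
  because a sum frozen with the component at most \<epsilon> may exceed it by \<delta>.\<close>

lemma prob_low_le:
  assumes \<theta>: "0 < \<theta>"
  shows "{\<omega> \<in> space M. V m \<omega> \<le> 2 * \<epsilon>} \<in> events"
    and "prob {\<omega> \<in> space M. V m \<omega> \<le> 2 * \<epsilon>} \<le> 2 * \<epsilon> * (1 / x
      + ((B * \<delta> + \<theta> * (real CARD('n) * B\<^sup>2)) * t m + (1 + 1 / \<theta>) * \<delta>) / (\<epsilon> / 2)^3
      + step_error CARD('n) C (\<epsilon> / 4) * sqrt d * t m)"
proof -
  define K where "K = B * \<delta> + \<theta> * (real CARD('n) * B\<^sup>2)"
  have K: "0 \<le> K" unfolding K_def using B \<delta> \<theta> by (intro add_nonneg_nonneg mult_nonneg_nonneg) auto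
  define g where "g \<omega> = (\<Sum>l<m. indicator (alive l) \<omega> * ((\<Sum>j\<in>UNIV. (c l j \<omega>)\<^sup>2) / V l \<omega>^3
      - \<mu> (X (t l) \<omega>) $ i / (V l \<omega>)\<^sup>2) * (t (Suc l) - t l))" for \<omega>
  have sub: "subalgebra M (F s)" for s using F by (simp add: filtered_prob_space_def)
  have Vm: "V m \<in> borel_measurable M"
  proof -
    have "V m \<in> borel_measurable (F (t m))"
      unfolding V_def[abs_def]
      using filtered_prob_space_sets_mono[OF F t_mono alive_sets]
      by (intro borel_measurable_add borel_measurable_sum borel_measurable_times borel_measurable_const
          borel_measurable_indicator incr_measurable) auto
    then show ?thesis by (rule measurable_from_subalg[OF sub])
  qed
  then show ev: "{\<omega> \<in> space M. V m \<omega> \<le> 2 * \<epsilon>} \<in> events" by measurable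
  have "g \<omega> \<le> (K * t m + (1 + 1 / \<theta>) * \<delta>) / (\<epsilon> / 2)^3" for \<omega>
  proof -
    have "g \<omega> \<le> (\<Sum>l<m. (K * (t (Suc l) - t l) + (1 + 1 / \<theta>) * (indicator (alive l) \<omega> * err l \<omega>)) / (\<epsilon> / 2)^3)"
      unfolding g_def
    proof (intro sum_mono)
      fix l
      show "indicator (alive l) \<omega> * ((\<Sum>j\<in>UNIV. (c l j \<omega>)\<^sup>2) / V l \<omega>^3
        - \<mu> (X (t l) \<omega>) $ i / (V l \<omega>)\<^sup>2) * (t (Suc l) - t l)
        \<le> (K * (t (Suc l) - t l) + (1 + 1 / \<theta>) * (indicator (alive l) \<omega> * err l \<omega>)) / (\<epsilon> / 2)^3"
      proof (cases "\<omega> \<in> alive l")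
        case True
        then show ?thesis using alive_drift[OF True \<theta>] by (simp add: K_def)
      next
        case False
        then show ?thesis using K t(2)[of l] \<epsilon> by simp
      qed
    qed
    also have "\<dots> = (K * t m + (1 + 1 / \<theta>) * (\<Sum>l<m. indicator (alive l) \<omega> * err l \<omega>)) / (\<epsilon> / 2)^3"
      using sum_lessThan_telescope[of t m] t(1)
      by (simp add: sum_divide_distrib[symmetric] sum.distrib sum_distrib_left[symmetric])
    also have "\<dots> \<le> (K * t m + (1 + 1 / \<theta>) * \<delta>) / (\<epsilon> / 2)^3"
      using sum_alive_err[where l=m and \<omega>=\<omega>] \<theta> \<epsilon> by (intro divide_right_mono add_left_mono mult_left_mono) auto
    finally show ?thesis .
  qed
  then have g_le: "expectation g \<le> (K * t m + (1 + 1 / \<theta>) * \<delta>) / (\<epsilon> / 2)^3" (is "_ \<le> ?G")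
  proof -
    have G0: "0 \<le> ?G" using K t_nonneg[of m] \<theta> \<delta> \<epsilon> by (intro divide_nonneg_nonneg add_nonneg_nonneg mult_nonneg_nonneg) auto
    assume *: "\<And>\<omega>. g \<omega> \<le> ?G"
    show ?thesis
    \<comment> \<open>A Bochner integral defaults to 0 for a non-integrable function, and the bound
      is nonnegative.\<close>
    proof (cases "integrable M g")
      case True
      then have "expectation g \<le> expectation (\<lambda>_. ?G)" using * by (intro integral_mono) auto
      then show ?thesis by (simp add: prob_space)
    next
      case False
      then show ?thesis using G0 by (simp add: not_integrable_integral_eq)
    qed
  qed
  have "expectation (\<lambda>\<omega>. 1 / max (V m \<omega>) (\<epsilon> / 4)) \<le> 1 / max x (\<epsilon> / 4) + expectation g
    + step_error CARD('n) C (\<epsilon> / 4) * sqrt d * (t m - t 0)"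
    unfolding g_def[abs_def]
  proof (rule stopped_euler_bound[OF F W])
    show "\<And>l. (\<lambda>\<omega>. \<mu> (X (t l) \<omega>) $ i) \<in> borel_measurable (F (t l))" by (rule drift_measurable) simp
    show "\<And>l \<omega>. V l \<omega> = x + (\<Sum>k<l. indicator (alive k) \<omega> * (\<mu> (X (t k) \<omega>) $ i * (t (Suc k) - t k)
        + (\<Sum>j\<in>UNIV. c k j \<omega> * (W (t (Suc k)) \<omega> - W (t k) \<omega>) $ j)))"
      by (simp add: V_def incr_def)
    show "\<And>l \<omega>. \<omega> \<in> alive l \<Longrightarrow> \<bar>\<mu> (X (t l) \<omega>) $ i\<bar> \<le> C"
      using B \<mu>_bound by (force simp: alive_def near_def)
    show "\<And>l \<omega> j. \<omega> \<in> alive l \<Longrightarrow> \<bar>c l j \<omega>\<bar> \<le> C"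
      using c_bound by (simp add: alive_def)
  qed (use t d alive_sets c \<epsilon> B alive_V(2) in auto)
  also have "\<dots> \<le> 1 / x + ?G + step_error CARD('n) C (\<epsilon> / 4) * sqrt d * t m"
    using g_le \<epsilon> t(1) by (simp add: max_def)
  finally have E: "expectation (\<lambda>\<omega>. 1 / max (V m \<omega>) (\<epsilon> / 4)) \<le> 1 / x + ?G + step_error CARD('n) C (\<epsilon> / 4) * sqrt d * t m" .
  have phi: "integrable M (\<lambda>\<omega>. 1 / max (V m \<omega>) (\<epsilon> / 4))"
  proof (rule integrable_const_bound)
    have "norm (1 / max v (\<epsilon> / 4)) \<le> 1 / (\<epsilon> / 4)" for v
    proof -
      have "1 / max v (\<epsilon> / 4) \<le> 1 / (\<epsilon> / 4)" by (rule frac_le) (use \<epsilon> in auto)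
      moreover have "0 \<le> 1 / max v (\<epsilon> / 4)" using \<epsilon> by (simp add: le_max_iff_disj)
      ultimately show ?thesis by (simp only: real_norm_def abs_of_nonneg)
    qed
    then show "AE \<omega> in M. norm (1 / max (V m \<omega>) (\<epsilon> / 4)) \<le> 1 / (\<epsilon> / 4)" by (intro AE_I2)
    show "(\<lambda>\<omega>. 1 / max (V m \<omega>) (\<epsilon> / 4)) \<in> borel_measurable M" using Vm by measurable
  qed
  have "prob {\<omega> \<in> space M. V m \<omega> \<le> 2 * \<epsilon>} * (1 / (2 * \<epsilon>)) = expectation (\<lambda>\<omega>. indicator {\<omega> \<in> space M. V m \<omega> \<le> 2 * \<epsilon>} \<omega> * (1 / (2 * \<epsilon>)))"
    using ev by (simp add: Bochner_Integration.integral_divide_zero)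
  also have "\<dots> \<le> expectation (\<lambda>\<omega>. 1 / max (V m \<omega>) (\<epsilon> / 4))"
  proof (rule integral_mono[OF _ phi])
    show "integrable M (\<lambda>\<omega>. indicator {\<omega> \<in> space M. V m \<omega> \<le> 2 * \<epsilon>} \<omega> * (1 / (2 * \<epsilon>)))"
      using ev by (intro integrable_mult_left integrable_real_indicator) (auto simp: emeasure_eq_measure)
    show "indicator {\<omega> \<in> space M. V m \<omega> \<le> 2 * \<epsilon>} \<omega> * (1 / (2 * \<epsilon>)) \<le> 1 / max (V m \<omega>) (\<epsilon> / 4)" for \<omega>
    proof (cases "V m \<omega> \<le> 2 * \<epsilon>")
      case True
      then have "1 / (2 * \<epsilon>) \<le> 1 / max (V m \<omega>) (\<epsilon> / 4)" using \<epsilon> by (intro frac_le) auto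
      then show ?thesis using \<epsilon> by (auto simp: indicator_def less_max_iff_disj)
    next
      case False
      then show ?thesis using \<epsilon> by (simp add: less_max_iff_disj)
    qed
  qed
  finally have "prob {\<omega> \<in> space M. V m \<omega> \<le> 2 * \<epsilon>} * (1 / (2 * \<epsilon>)) \<le> 1 / x + ?G + step_error CARD('n) C (\<epsilon> / 4) * sqrt d * t m"
    using E by linarith
  then show "prob {\<omega> \<in> space M. V m \<omega> \<le> 2 * \<epsilon>} \<le> 2 * \<epsilon> * (1 / x
      + ((B * \<delta> + \<theta> * (real CARD('n) * B\<^sup>2)) * t m + (1 + 1 / \<theta>) * \<delta>) / (\<epsilon> / 2)^3
      + step_error CARD('n) C (\<epsilon> / 4) * sqrt d * t m)"
    using \<epsilon> unfolding K_def[symmetric] by (simp add: divide_le_eq mult.commute)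
qed

end

section \<open>Error estimates along one path, and small exceptional events\<close>

lemma riemann_sum_error:
  fixes f :: "real \<Rightarrow> real" and t :: "nat \<Rightarrow> real"
  assumes t: "t 0 = 0" "\<And>l. t l \<le> t (Suc l)" "\<And>l. t (Suc l) - t l \<le> d" "\<And>l. t l \<le> T"
    and f: "continuous_on {0..T} f"
    and w: "\<And>u v. u \<in> {0..T} \<Longrightarrow> v \<in> {0..T} \<Longrightarrow> \<bar>u - v\<bar> \<le> d \<Longrightarrow> \<bar>f u - f v\<bar> \<le> w"
  shows "\<bar>(\<Sum>k<l. f (t k) * (t (Suc k) - t k)) - integral {0..t l} f\<bar> \<le> w * t l"
proof (induction l)
  case 0
  then show ?case by (simp add: t)
next
  case (Suc l)
  have t0: "0 \<le> t l" using lift_Suc_mono_le[of t 0 l, OF t(2)] t(1) by simp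
  have int: "f integrable_on {a..b}" if "0 \<le> a" "b \<le> T" for a b
    using that by (intro integrable_continuous_interval continuous_on_subset[OF f]) auto
  have comb: "integral {0..t l} f + integral {t l..t (Suc l)} f = integral {0..t (Suc l)} f"
    using t0 t(2)[of l] t(4)[of "Suc l"] by (intro Henstock_Kurzweil_Integration.integral_combine int) auto
  have "norm (integral {t l..t (Suc l)} (\<lambda>s. f (t l) - f s)) \<le> integral {t l..t (Suc l)} (\<lambda>s. w)"
  proof (rule integral_norm_bound_integral)
    show "(\<lambda>s. f (t l) - f s) integrable_on {t l..t (Suc l)}"
      using t0 t(4)[of "Suc l"] by (intro integrable_diff int) (auto simp: integrable_const_ivl)
    show "norm (f (t l) - f s) \<le> w" if "s \<in> {t l..t (Suc l)}" for s
      using that t0 t(3)[of l] t(4)[of l] t(4)[of "Suc l"] w[of "t l" s] by auto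
  qed (simp add: integrable_const_ivl)
  moreover have "integral {t l..t (Suc l)} (\<lambda>s. f (t l) - f s) = f (t l) * (t (Suc l) - t l) - integral {t l..t (Suc l)} f"
    using t0 t(2)[of l] t(4)[of "Suc l"]
    by (subst Henstock_Kurzweil_Integration.integral_diff) (auto intro: int simp: integrable_const_ivl mult.commute)
  ultimately have "\<bar>f (t l) * (t (Suc l) - t l) - integral {t l..t (Suc l)} f\<bar> \<le> w * (t (Suc l) - t l)"
    using t(2)[of l] by (simp add: mult.commute)
  with Suc comb show ?case by (simp add: right_diff_distrib)
qed

text \<open>On a cell, c - h (t k) splits into c - h s and h s - h (t k). Squaring costs a factor 2;
  integration over \<open>s\<close> turns the first part into the L2 distance, while the second is
  at most \<open>w\<close>.\<close>

lemma quadratic_sum_error: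
  fixes h :: "real \<Rightarrow> real" and t c :: "nat \<Rightarrow> real"
  assumes t: "t 0 = 0" "\<And>l. t l \<le> t (Suc l)" "\<And>l. t (Suc l) - t l \<le> d" "\<And>l. t l \<le> T"
    and h: "continuous_on {0..T} h"
    and w: "\<And>u v. u \<in> {0..T} \<Longrightarrow> v \<in> {0..T} \<Longrightarrow> \<bar>u - v\<bar> \<le> d \<Longrightarrow> \<bar>h u - h v\<bar> \<le> w"
    and c: "\<And>k s. t k < s \<Longrightarrow> s \<le> t (Suc k) \<Longrightarrow> S s = c k"
    and S[measurable]: "S \<in> borel_measurable borel"
    and a: "0 \<le> a" "(\<integral>\<^sup>+s\<in>{0..T}. ennreal ((S s - h s)\<^sup>2) \<partial>lborel) \<le> ennreal a"
    and w0: "0 \<le> w"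
  shows "(\<Sum>k<l. (c k - h (t k))\<^sup>2 * (t (Suc k) - t k)) \<le> 2 * a + 2 * w\<^sup>2 * T"
proof -
  have t0: "0 \<le> t l" for l using lift_Suc_mono_le[of t 0 l, OF t(2)] t(1) by simp
  have T: "0 \<le> T" using t(4)[of 0] t(1) by simp
  \<comment> \<open>\<open>h\<close> is controlled only on [0, T]; cutting it off there gives a
    Borel function on the whole line.\<close>
  define q where "q s = S s - indicator {0..T} s *\<^sub>R h s" for s
  have [measurable]: "(\<lambda>s. indicator {0..T} s *\<^sub>R h s) \<in> borel_measurable borel"
    by (intro borel_measurable_continuous_on_indicator h) simp
  have [measurable]: "q \<in> borel_measurable borel" unfolding q_def[abs_def] by measurable
  have sq: "(x + y)\<^sup>2 \<le> 2 * x\<^sup>2 + 2 * y\<^sup>2" for x y :: real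
    using sum_squares_bound[of x y] by (simp add: power2_sum)
  have claim: "ennreal (\<Sum>k<l. (c k - h (t k))\<^sup>2 * (t (Suc k) - t k))
    \<le> (\<integral>\<^sup>+s. ennreal (2 * (q s)\<^sup>2 + 2 * w\<^sup>2) * indicator {0<..t l} s \<partial>lborel)" for l
  proof (induction l)
    case (Suc l)
    have "ennreal ((c l - h (t l))\<^sup>2 * (t (Suc l) - t l)) = (\<integral>\<^sup>+s. ennreal ((c l - h (t l))\<^sup>2) * indicator {t l<..t (Suc l)} s \<partial>lborel)"
      using t(2)[of l] by (subst nn_integral_cmult_indicator) (auto simp: ennreal_mult)
    also have "\<dots> \<le> (\<integral>\<^sup>+s. ennreal (2 * (q s)\<^sup>2 + 2 * w\<^sup>2) * indicator {t l<..t (Suc l)} s \<partial>lborel)"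
    proof (intro nn_integral_mono)
      fix s
      show "ennreal ((c l - h (t l))\<^sup>2) * indicator {t l<..t (Suc l)} s
        \<le> ennreal (2 * (q s)\<^sup>2 + 2 * w\<^sup>2) * indicator {t l<..t (Suc l)} s"
      proof (cases "s \<in> {t l<..t (Suc l)}")
        case True
        have s: "s \<in> {0..T}" using True t0[of l] t(4)[of "Suc l"] by auto
        have "q s = c l - h s" using c[of l s] True s by (simp add: q_def)
        moreover have "\<bar>h s - h (t l)\<bar> \<le> w"
          using True t0[of l] t(3)[of l] t(4)[of l] by (intro w s) auto
        then have "(h s - h (t l))\<^sup>2 \<le> w\<^sup>2" using w0 by (simp add: abs_le_square_iff[symmetric])
        ultimately have "(c l - h (t l))\<^sup>2 \<le> 2 * (q s)\<^sup>2 + 2 * w\<^sup>2"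
          using sq[of "c l - h s" "h s - h (t l)"] by simp
        then show ?thesis using True by (simp add: ennreal_leI del: ennreal_plus)
      qed simp
    qed
    finally have "ennreal (\<Sum>k<Suc l. (c k - h (t k))\<^sup>2 * (t (Suc k) - t k))
      \<le> (\<integral>\<^sup>+s. ennreal (2 * (q s)\<^sup>2 + 2 * w\<^sup>2) * indicator {0<..t l} s \<partial>lborel)
        + (\<integral>\<^sup>+s. ennreal (2 * (q s)\<^sup>2 + 2 * w\<^sup>2) * indicator {t l<..t (Suc l)} s \<partial>lborel)"
      using Suc t(2) by (simp add: ennreal_plus sum_nonneg add_mono)
    also have "\<dots> = (\<integral>\<^sup>+s. ennreal (2 * (q s)\<^sup>2 + 2 * w\<^sup>2) * indicator {0<..t (Suc l)} s \<partial>lborel)"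
      using t0[of l] t(2)[of l]
      by (subst nn_integral_add[symmetric]) (auto intro!: nn_integral_cong split: split_indicator)
    finally show ?case .
  qed simp
  have "ennreal (\<Sum>k<l. (c k - h (t k))\<^sup>2 * (t (Suc k) - t k))
    \<le> (\<integral>\<^sup>+s. ennreal (2 * (q s)\<^sup>2 + 2 * w\<^sup>2) * indicator {0<..t l} s \<partial>lborel)" by (rule claim)
  also have "\<dots> \<le> (\<integral>\<^sup>+s. 2 * (ennreal ((q s)\<^sup>2) * indicator {0..T} s) + ennreal (2 * w\<^sup>2) * indicator {0..T} s \<partial>lborel)"
    using t(4)[of l] by (intro nn_integral_mono) (auto simp: ennreal_plus ennreal_mult split: split_indicator)
  also have "\<dots> = 2 * (\<integral>\<^sup>+s. ennreal ((q s)\<^sup>2) * indicator {0..T} s \<partial>lborel) + ennreal (2 * w\<^sup>2) * ennreal T"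
    using T by (subst nn_integral_add) (auto simp: nn_integral_cmult)
  also have "(\<integral>\<^sup>+s. ennreal ((q s)\<^sup>2) * indicator {0..T} s \<partial>lborel) = (\<integral>\<^sup>+s\<in>{0..T}. ennreal ((S s - h s)\<^sup>2) \<partial>lborel)"
    by (intro nn_integral_cong) (auto simp: q_def split: split_indicator)
  also have "2 * \<dots> + ennreal (2 * w\<^sup>2) * ennreal T \<le> 2 * ennreal a + ennreal (2 * w\<^sup>2) * ennreal T"
    by (intro add_right_mono mult_left_mono a(2)) auto
  also have "\<dots> = ennreal (2 * a + 2 * w\<^sup>2 * T)"
    using a(1) T by (simp add: ennreal_plus ennreal_mult)
  finally show ?thesis using a(1) T by (subst (asm) ennreal_le_iff) auto
qed

text \<open>One index serves both modes of convergence, each spending half of \<eta>. The events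
  covering the outer sets in \<open>tendsto_zero_in_prob\<close> make the exceptional set
  measurable.\<close>

lemma (in prob_space) ito_integral_simple_approximation:
  assumes I: "has_ito_integral M F B H I" and T: "0 \<le> T" and a: "0 < a" and \<eta>: "0 < \<eta>"
  shows "\<exists>S A. simple_process M F S \<and> A \<in> events \<and> prob A < \<eta> \<and> (\<forall>\<omega>\<in>space M - A.
    (\<integral>\<^sup>+s\<in>{0..T}. ennreal ((simple_value S s \<omega> - H s \<omega>)\<^sup>2) \<partial>lborel) \<le> ennreal a \<and>
    (\<forall>t\<in>{0..T}. \<bar>simple_integral B S t \<omega> - I t \<omega>\<bar> \<le> a))"
proof -
  obtain S where S: "\<And>k. simple_process M F (S k)"
    and S1: "tendsto_zero_in_prob M (\<lambda>k \<omega>. \<integral>\<^sup>+s\<in>{0..T}. ennreal ((simple_value (S k) s \<omega> - H s \<omega>)\<^sup>2) \<partial>lborel)"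
    and S2: "tendsto_zero_in_prob M (\<lambda>k \<omega>. SUP t\<in>{0..T}. ennreal \<bar>simple_integral B (S k) t \<omega> - I t \<omega>\<bar>)"
    using I T unfolding has_ito_integral_def by blast
  have \<eta>2: "0 < \<eta> / 2" using \<eta> by simp
  have "\<forall>\<^sub>F k in sequentially. (\<exists>A\<in>events. {\<omega> \<in> space M. ennreal a < (\<integral>\<^sup>+s\<in>{0..T}. ennreal ((simple_value (S k) s \<omega> - H s \<omega>)\<^sup>2) \<partial>lborel)} \<subseteq> A \<and> prob A < \<eta> / 2)
    \<and> (\<exists>A\<in>events. {\<omega> \<in> space M. ennreal a < (SUP t\<in>{0..T}. ennreal \<bar>simple_integral B (S k) t \<omega> - I t \<omega>\<bar>)} \<subseteq> A \<and> prob A < \<eta> / 2)"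
    by (rule eventually_conj[OF S1[unfolded tendsto_zero_in_prob_def, rule_format, OF a \<eta>2]
        S2[unfolded tendsto_zero_in_prob_def, rule_format, OF a \<eta>2]])
  then obtain k where k: "(\<exists>A\<in>events. {\<omega> \<in> space M. ennreal a < (\<integral>\<^sup>+s\<in>{0..T}. ennreal ((simple_value (S k) s \<omega> - H s \<omega>)\<^sup>2) \<partial>lborel)} \<subseteq> A \<and> prob A < \<eta> / 2)
    \<and> (\<exists>A\<in>events. {\<omega> \<in> space M. ennreal a < (SUP t\<in>{0..T}. ennreal \<bar>simple_integral B (S k) t \<omega> - I t \<omega>\<bar>)} \<subseteq> A \<and> prob A < \<eta> / 2)"
    unfolding eventually_sequentially by blast
  then obtain A1 A2 where A: "A1 \<in> events" "A2 \<in> events" "prob A1 < \<eta> / 2" "prob A2 < \<eta> / 2"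
    and A1: "{\<omega> \<in> space M. ennreal a < (\<integral>\<^sup>+s\<in>{0..T}. ennreal ((simple_value (S k) s \<omega> - H s \<omega>)\<^sup>2) \<partial>lborel)} \<subseteq> A1"
    and A2: "{\<omega> \<in> space M. ennreal a < (SUP t\<in>{0..T}. ennreal \<bar>simple_integral B (S k) t \<omega> - I t \<omega>\<bar>)} \<subseteq> A2"
    by blast
  show ?thesis
  proof (intro exI[of _ "S k"] exI[of _ "A1 \<union> A2"] conjI ballI S)
    show "A1 \<union> A2 \<in> events" using A by auto
    show "prob (A1 \<union> A2) < \<eta>" using measure_Un_le[OF A(1,2)] A(3,4) by linarith
    fix \<omega> assume \<omega>: "\<omega> \<in> space M - (A1 \<union> A2)"
    show "(\<integral>\<^sup>+s\<in>{0..T}. ennreal ((simple_value (S k) s \<omega> - H s \<omega>)\<^sup>2) \<partial>lborel) \<le> ennreal a"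
      using \<omega> A1 by (auto simp: not_less[symmetric])
    fix t assume t: "t \<in> {0..T}"
    have "ennreal \<bar>simple_integral B (S k) t \<omega> - I t \<omega>\<bar> \<le> (SUP t\<in>{0..T}. ennreal \<bar>simple_integral B (S k) t \<omega> - I t \<omega>\<bar>)"
      by (rule SUP_upper[OF t])
    also have "\<dots> \<le> ennreal a" using \<omega> A2 by (auto simp: not_less[symmetric])
    finally show "\<bar>simple_integral B (S k) t \<omega> - I t \<omega>\<bar> \<le> a" using a by simp
  qed
qed

text \<open>Serves to let the mesh depend on the path: a bad path need only lie in all
  \<open>E N\<close> from some \<open>N\<close> on. The tail intersections increase, so continuity
  from below preserves the bound.\<close>

lemma (in prob_space) prob_liminf_le:
  fixes E :: "nat \<Rightarrow> 'a set"
  assumes E: "\<And>N. E N \<in> events" and p: "\<And>N. N0 \<le> N \<Longrightarrow> prob (E N) \<le> p"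
  shows "(\<Union>m. \<Inter>N\<in>{m..}. E N) \<in> events" and "prob (\<Union>m. \<Inter>N\<in>{m..}. E N) \<le> p"
proof -
  define G where "G m = (\<Inter>N\<in>{m..}. E N)" for m
  have G: "G m \<in> events" for m unfolding G_def using E by (intro sets.countable_INT) auto
  show "(\<Union>m. \<Inter>N\<in>{m..}. E N) \<in> events" using G unfolding G_def by auto
  have "(\<lambda>m. prob (G m)) \<longlonglongrightarrow> prob (\<Union>m. G m)"
    by (rule finite_Lim_measure_incseq) (use G in \<open>auto simp: incseq_def G_def\<close>)
  moreover have "prob (G m) \<le> p" for m
  proof -
    have "prob (G m) \<le> prob (E (max m N0))"
      by (intro finite_measure_mono E) (auto simp: G_def)
    also have "\<dots> \<le> p" by (rule p) simp
    finally show ?thesis .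
  qed
  ultimately show "prob (\<Union>m. \<Inter>N\<in>{m..}. E N) \<le> p"
    unfolding G_def[symmetric] by (intro LIMSEQ_le_const2) auto
qed

section \<open>The Euler sums along one path of the solution\<close>

context euler_scheme
begin

text \<open>On a good path the only condition of \<open>near\<close> that can fail before the exit
  time \<open>s\<close> is \<epsilon> < X_i, and it does fail at some grid point since the grid
  meets [s - d, s). There the scheme freezes, at a value of at most \<epsilon> + \<delta>.\<close>

lemma V_low_at_exit:
  assumes \<omega>: "\<omega> \<in> space M" and T: "t m = T" "\<And>l. t l \<le> T"
    and bounded: "\<And>s. s \<in> {0..T} \<Longrightarrow> norm (X s \<omega>) \<le> R"
    and close: "\<And>l. \<bar>Z l \<omega> - X (t l) \<omega> $ i\<bar> \<le> \<delta>"
    and errs: "\<And>l. (\<Sum>k\<le>l. err k \<omega>) \<le> \<delta>"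
    and s: "d < s" "s \<le> T" and before: "\<And>u. 0 \<le> u \<Longrightarrow> u < s \<Longrightarrow> X u \<omega> \<in> pos_orthant"
    and exit: "\<And>u. s - d \<le> u \<Longrightarrow> u < s \<Longrightarrow> X u \<omega> $ i \<le> \<epsilon>"
  shows "V m \<omega> \<le> 2 * \<epsilon>"
proof -
  have d0: "0 \<le> d" using t(2,3)[of 0] by simp
  \<comment> \<open>The grid index just before \<open>L\<close> is the last one before the exit
    time, within one mesh width of it.\<close>
  define L where "L = (LEAST l. s \<le> t l)"
  have "s \<le> t m" using s T by simp
  then have L: "s \<le> t L" "\<And>l. l < L \<Longrightarrow> t l < s"
    unfolding L_def by (auto intro: LeastI dest: not_less_Least)
  obtain L' where L': "L = Suc L'" using L(1) t(1) s d0 by (cases L) auto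
  have tL': "t L' < s" "s - d \<le> t L'" using L(2)[of L'] L(1) t(3)[of L'] by (auto simp: L')
  then have ex: "X (t L') \<omega> $ i \<le> \<epsilon>" using exit by auto
  \<comment> \<open>The freezing index: the first grid point at which the component is at most
    \<epsilon>.\<close>
  define \<kappa> where "\<kappa> = (LEAST l. X (t l) \<omega> $ i \<le> \<epsilon>)"
  have \<kappa>: "X (t \<kappa>) \<omega> $ i \<le> \<epsilon>" "\<kappa> \<le> L'" "\<And>l. l < \<kappa> \<Longrightarrow> \<epsilon> < X (t l) \<omega> $ i"
    unfolding \<kappa>_def using ex by (auto intro: LeastI Least_le simp: not_le[symmetric] dest: not_less_Least)
  have "near k \<omega>" if "k < \<kappa>" for k
  proof -
    have "t k < s" using L(2)[of k] that \<kappa>(2) L' by simp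
    then show ?thesis
      unfolding near_def using \<kappa>(3)[OF that] bounded[of "t k"] t_nonneg[of k] T(2)[of k] before[of "t k"] close errs
      by simp
  qed
  then have "\<omega> \<in> alive k" if "k < \<kappa>" for k using that \<omega> by (auto simp: alive_def)
  moreover have "\<omega> \<notin> alive \<kappa>" using \<kappa>(1) by (auto simp: alive_def near_def)
  moreover have "\<kappa> \<le> m"
  proof (rule ccontr)
    assume "\<not> \<kappa> \<le> m"
    then have "m < L" using \<kappa>(2) L' by simp
    then have "t m < s" by (rule L(2))
    then show False using T s by simp
  qed
  ultimately have "V m \<omega> = Z \<kappa> \<omega>" by (rule V_stopped)
  then show ?thesis using close[of \<kappa>] \<kappa>(1) \<delta> \<epsilon> by simp
qed

text \<open>On each cell the noise term is exactly an increment of the simple integral, so the noise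
  telescopes. What remains is the Riemann error of the drift, w t_l, and the distance
  \<open>a\<close> to each of the Ito integrals.\<close>

lemma Z_close:
  assumes T: "\<And>l. t l \<le> T"
    and S: "\<And>j. simple_process M F (N j, \<tau> j, \<xi> j)"
    and avoid: "\<And>j k l. k \<le> N j \<Longrightarrow> \<not> (t l < \<tau> j k \<and> \<tau> j k < t (Suc l))"
    and c_eq: "\<And>k j. t k < t (Suc k) \<Longrightarrow> c k j \<omega> = simple_value (N j, \<tau> j, \<xi> j) (t (Suc k)) \<omega>"
    and cont: "continuous_on {0..T} (\<lambda>s. \<mu> (X s \<omega>) $ i)"
    and w: "\<And>u v. u \<in> {0..T} \<Longrightarrow> v \<in> {0..T} \<Longrightarrow> \<bar>u - v\<bar> \<le> d \<Longrightarrow> \<bar>\<mu> (X u \<omega>) $ i - \<mu> (X v \<omega>) $ i\<bar> \<le> w"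
    and sde: "\<And>s. 0 \<le> s \<Longrightarrow> X s \<omega> $ i = x + integral {0..s} (\<lambda>s. \<mu> (X s \<omega>) $ i) + (\<Sum>j\<in>UNIV. I j s \<omega>)"
    and approx: "\<And>j s. s \<in> {0..T} \<Longrightarrow> \<bar>simple_integral (\<lambda>s \<omega>. W s \<omega> $ j) (N j, \<tau> j, \<xi> j) s \<omega> - I j s \<omega>\<bar> \<le> a"
  shows "\<bar>Z l \<omega> - X (t l) \<omega> $ i\<bar> \<le> w * t l + real CARD('n) * a"
proof -
  define J where "J j = simple_integral (\<lambda>s \<omega>. W s \<omega> $ j) (N j, \<tau> j, \<xi> j)" for j
  have cell: "J j (t (Suc k)) \<omega> - J j (t k) \<omega> = c k j \<omega> * (W (t (Suc k)) \<omega> - W (t k) \<omega>) $ j" for j k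
  proof (cases "t k < t (Suc k)")
    case True
    then show ?thesis
      unfolding J_def using simple_integral_increment(1)[OF S True avoid, of j "\<lambda>s \<omega>. W s \<omega> $ j" \<omega>] c_eq[OF True]
      by simp
  next
    case False
    then have "t (Suc k) = t k" using t(2)[of k] by simp
    then show ?thesis by simp
  qed
  have tele: "(\<Sum>k<l. c k j \<omega> * (W (t (Suc k)) \<omega> - W (t k) \<omega>) $ j) = J j (t l) \<omega>" for j
    unfolding cell[symmetric] using sum_lessThan_telescope[of "\<lambda>k. J j (t k) \<omega>" l]
    by (simp add: t(1) J_def simple_integral_at_0[OF S] del: simple_integral.simps)
  have "Z l \<omega> = x + (\<Sum>k<l. \<mu> (X (t k) \<omega>) $ i * (t (Suc k) - t k)) + (\<Sum>j\<in>UNIV. J j (t l) \<omega>)"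
    unfolding Z_def incr_def sum.distrib tele[symmetric] by (subst sum.swap) simp
  moreover have "\<bar>(\<Sum>j\<in>UNIV. J j (t l) \<omega>) - (\<Sum>j\<in>UNIV. I j (t l) \<omega>)\<bar> \<le> real CARD('n) * a"
  proof -
    have "\<bar>\<Sum>j\<in>UNIV. J j (t l) \<omega> - I j (t l) \<omega>\<bar> \<le> (\<Sum>j\<in>(UNIV::'n set). a)"
      unfolding J_def using approx t_nonneg[of l] T[of l] by (intro order_trans[OF sum_abs] sum_mono) auto
    then show ?thesis by (simp add: sum_subtractf)
  qed
  moreover have "\<bar>(\<Sum>k<l. \<mu> (X (t k) \<omega>) $ i * (t (Suc k) - t k)) - integral {0..t l} (\<lambda>s. \<mu> (X s \<omega>) $ i)\<bar> \<le> w * t l"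
    by (rule riemann_sum_error[OF t T cont w])
  ultimately show ?thesis using sde[OF t_nonneg[of l]] by linarith
qed

lemma err_sum_le:
  assumes T: "\<And>l. t l \<le> T"
    and S: "\<And>j. simple_process M F (N j, \<tau> j, \<xi> j)"
    and avoid: "\<And>j k l. k \<le> N j \<Longrightarrow> \<not> (t l < \<tau> j k \<and> \<tau> j k < t (Suc l))"
    and c_eq: "\<And>k j. t k < t (Suc k) \<Longrightarrow> c k j \<omega> = simple_value (N j, \<tau> j, \<xi> j) (t (Suc k)) \<omega>"
    and cont: "\<And>j. continuous_on {0..T} (\<lambda>s. \<sigma> (X s \<omega>) $ i $ j)"
    and w: "\<And>j u v. u \<in> {0..T} \<Longrightarrow> v \<in> {0..T} \<Longrightarrow> \<bar>u - v\<bar> \<le> d \<Longrightarrow> \<bar>\<sigma> (X u \<omega>) $ i $ j - \<sigma> (X v \<omega>) $ i $ j\<bar> \<le> w"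
    and w0: "0 \<le> w" and a0: "0 \<le> a"
    and approx: "\<And>j. (\<integral>\<^sup>+s\<in>{0..T}. ennreal ((simple_value (N j, \<tau> j, \<xi> j) s \<omega> - \<sigma> (X s \<omega>) $ i $ j)\<^sup>2) \<partial>lborel) \<le> ennreal a"
  shows "(\<Sum>k\<le>l. err k \<omega>) \<le> real CARD('n) * (2 * a + 2 * w\<^sup>2 * T)"
proof -
  have "(\<Sum>k<Suc l. (c k j \<omega> - \<sigma> (X (t k) \<omega>) $ i $ j)\<^sup>2 * (t (Suc k) - t k)) \<le> 2 * a + 2 * w\<^sup>2 * T" for j
  proof (rule quadratic_sum_error[OF t T cont w _ _ a0 approx w0])
    fix k s assume s: "t k < s" "s \<le> t (Suc k)"
    then have "t k < t (Suc k)" by simp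
    then show "simple_value (N j, \<tau> j, \<xi> j) s \<omega> = c k j \<omega>"
      using simple_integral_increment(2)[OF S _ avoid s] c_eq by metis
  next
    show "(\<lambda>s. simple_value (N j, \<tau> j, \<xi> j) s \<omega>) \<in> borel_measurable borel"
      unfolding simple_value.simps by measurable
  qed
  then have "(\<Sum>j\<in>UNIV. \<Sum>k<Suc l. (c k j \<omega> - \<sigma> (X (t k) \<omega>) $ i $ j)\<^sup>2 * (t (Suc k) - t k))
    \<le> (\<Sum>j\<in>(UNIV::'n set). 2 * a + 2 * w\<^sup>2 * T)"
    by (intro sum_mono)
  moreover have "(\<Sum>k\<le>l. err k \<omega>) = (\<Sum>j\<in>UNIV. \<Sum>k<Suc l. (c k j \<omega> - \<sigma> (X (t k) \<omega>) $ i $ j)\<^sup>2 * (t (Suc k) - t k))"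
    unfolding err_def sum_distrib_right lessThan_Suc_atMost by (rule sum.swap)
  ultimately show ?thesis by simp
qed

end

section \<open>Exit from the orthant\<close>

text \<open>The path properties are premises inside the conclusion: they hold only almost surely, on
  sets that need not be measurable, whereas \<open>A\<close> is an event. The bad paths are covered
  by the failures of the simple approximation and by the paths whose schemes end low on all fine
  grids; each part has probability at most \<eta> / 4.\<close>

lemma (in prob_space) exit_event_small:
  fixes W X :: "real \<Rightarrow> 'a \<Rightarrow> real^'n" and i :: 'n
  assumes F: "filtered_prob_space M F" and W: "wiener_process M F W" and X: "adapted F X"
    and \<mu>: "continuous_on UNIV \<mu>" and \<sigma>: "continuous_on UNIV \<sigma>"
    and drift_dominates: "\<And>y. y \<in> pos_orthant \<Longrightarrow> (\<Sum>j\<in>UNIV. (\<sigma> y $ i $ j)\<^sup>2) \<le> \<mu> y $ i * y $ i"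
    and \<mu>_bound: "\<And>y. norm y \<le> R \<Longrightarrow> \<bar>\<mu> y $ i\<bar> \<le> B"
    and \<sigma>_bound: "\<And>y j. norm y \<le> R \<Longrightarrow> \<bar>\<sigma> y $ i $ j\<bar> \<le> B" and B: "0 \<le> B"
    and I: "\<And>j. has_ito_integral M F (\<lambda>t \<omega>. W t \<omega> $ j) (\<lambda>t \<omega>. \<sigma> (X t \<omega>) $ i $ j) (I j)"
    and T: "0 < T" and x: "0 < x" and \<eta>: "0 < \<eta>"
  shows "\<exists>A\<in>events. prob A < \<eta> \<and> (\<forall>\<omega>\<in>space M - A.
    continuous_on {0..} (\<lambda>s. X s \<omega>) \<longrightarrow> X 0 \<omega> $ i = x \<longrightarrow>
    (\<forall>s\<ge>0. X s \<omega> $ i = x + integral {0..s} (\<lambda>s. \<mu> (X s \<omega>) $ i) + (\<Sum>j\<in>UNIV. I j s \<omega>)) \<longrightarrow>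
    (\<forall>s\<in>{0..T}. norm (X s \<omega>) \<le> R) \<longrightarrow>
    \<not> (\<exists>s\<in>{0..T}. X s \<omega> $ i \<le> 0 \<and> (\<forall>u\<in>{0..<s}. X u \<omega> \<in> pos_orthant)))"
proof -
  define n where "n = real CARD('n)"
  have n: "1 \<le> n" by (simp add: n_def Suc_leI)
  \<comment> \<open>Chosen to give 2 \<epsilon> (1 / x + 1) \<le> \<eta> / 4. The extra 1 is room
    for the drift error and the discretisation error, 1 / 2 each.\<close>
  define \<epsilon> where "\<epsilon> = min (x / 2) (\<eta> / (8 * (1 / x + 1)))"
  have x1: "0 < 1 / x + 1" using x by (simp add: add_pos_pos)
  have "0 < \<eta> / (8 * (1 / x + 1))" using \<eta> x1 by (intro divide_pos_pos mult_pos_pos) auto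
  then have "0 < \<epsilon>" using x by (simp add: \<epsilon>_def)
  moreover have "\<epsilon> \<le> x / 2" unfolding \<epsilon>_def by (rule min.cobounded1)
  ultimately have \<epsilon>: "0 < \<epsilon>" "\<epsilon> < x" using x by auto
  have "\<epsilon> \<le> \<eta> / (8 * (1 / x + 1))" unfolding \<epsilon>_def by (rule min.cobounded2)
  then have \<epsilon>\<eta>: "2 * \<epsilon> * (1 / x + 1) \<le> \<eta> / 4" using x1
    by (subst (asm) pos_le_divide_eq) (auto simp: mult_ac)
  define K where "K = (\<epsilon> / 2)^3"
  have K: "0 < K" using \<epsilon> by (simp add: K_def)
  \<comment> \<open>The summand 1 keeps the denominator of \<theta> positive when \<open>B\<close>
    is 0.\<close>
  define D where "D = n * B\<^sup>2 * T + 1"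
  have D: "0 < D" using n T by (simp add: D_def add_nonneg_pos)
  define \<theta> where "\<theta> = K / (4 * D)"
  have \<theta>: "0 < \<theta>" using K D by (simp add: \<theta>_def)
  have "\<theta> * D = K / 4" using D by (simp add: \<theta>_def)
  then have \<theta>K: "\<theta> * (n * B\<^sup>2 * T) \<le> K / 4" using \<theta> by (simp add: D_def distrib_left)
  \<comment> \<open>Collects the factors of \<delta> in the drift error, once \<theta> is
    fixed.\<close>
  define Q where "Q = B * T + 1 + 1 / \<theta>"
  have Q: "0 < Q" using B T \<theta> by (simp add: Q_def add_nonneg_pos)
  define \<delta> where "\<delta> = min (\<epsilon> / 2) (K / (4 * Q))"
  have \<delta>: "0 < \<delta>" "\<delta> \<le> \<epsilon> / 2" using \<epsilon> K Q by (auto simp: \<delta>_def)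
  have "\<delta> \<le> K / (4 * Q)" unfolding \<delta>_def by (rule min.cobounded2)
  then have \<delta>K: "\<delta> * Q \<le> K / 4" using Q by (simp add: pos_le_divide_eq mult_ac)
  have drift_small: "((B * \<delta> + \<theta> * (n * B\<^sup>2)) * T + (1 + 1 / \<theta>) * \<delta>) / (\<epsilon> / 2)^3 \<le> 1 / 2"
  proof -
    have "(B * \<delta> + \<theta> * (n * B\<^sup>2)) * T + (1 + 1 / \<theta>) * \<delta> = \<delta> * Q + \<theta> * (n * B\<^sup>2 * T)"
      by (simp add: Q_def algebra_simps)
    also have "\<dots> \<le> K / 2" using \<delta>K \<theta>K by simp
    finally show ?thesis using K unfolding K_def[symmetric] by (simp add: pos_divide_le_eq)
  qed
  define a where "a = \<delta> / (4 * n)"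
  have a: "0 < a" "n * a = \<delta> / 4" using \<delta> n by (auto simp: a_def)
  \<comment> \<open>The cap at 1 gives w^2 \<le> w, so that one choice serves both the drift error
    and the quadratic error.\<close>
  define w where "w = min 1 (\<delta> / (4 * n * (T + 1)))"
  have w: "0 < w" "w \<le> 1" using \<delta> n T by (auto simp: w_def)
  have nT: "0 < 4 * n * (T + 1)" using n T by simp
  have "w \<le> \<delta> / (4 * n * (T + 1))" unfolding w_def by (rule min.cobounded2)
  then have "w * (4 * n * (T + 1)) \<le> \<delta>" using nT by (simp only: pos_le_divide_eq)
  moreover have "w * (4 * n * T) \<le> w * (4 * n * (T + 1))" using w n by (intro mult_left_mono) auto
  ultimately have nwT: "n * w * T \<le> \<delta> / 4" by (simp add: mult_ac)
  have "1 * (w * T) \<le> n * (w * T)" using n w T by (intro mult_right_mono) auto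
  then have wT: "w * T \<le> \<delta> / 4" using nwT by (simp add: mult_ac)
  have "w\<^sup>2 \<le> w" using w by (simp add: power2_eq_square mult_left_le)
  then have "n * T * w\<^sup>2 \<le> n * T * w" using n T by (intro mult_left_mono) auto
  then have w2: "n * (2 * a + 2 * w\<^sup>2 * T) \<le> \<delta>"
    using nwT a(2) \<delta>(1) by (simp add: algebra_simps)

  define good where "good j S A \<longleftrightarrow> simple_process M F S \<and> A \<in> events \<and> prob A < \<eta> / (4 * n) \<and> (\<forall>\<omega>\<in>space M - A.
    (\<integral>\<^sup>+s\<in>{0..T}. ennreal ((simple_value S s \<omega> - \<sigma> (X s \<omega>) $ i $ j)\<^sup>2) \<partial>lborel) \<le> ennreal a \<and>
    (\<forall>t\<in>{0..T}. \<bar>simple_integral (\<lambda>t \<omega>. W t \<omega> $ j) S t \<omega> - I j t \<omega>\<bar> \<le> a))" for j S A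
  have "\<exists>S A. good j S A" for j
    unfolding good_def by (rule ito_integral_simple_approximation[OF I]) (use T a \<eta> n in auto)
  then obtain S A where good: "\<And>j. good j (S j) (A j)" by metis
  have SA: "simple_process M F (S j)" "A j \<in> events" "prob (A j) < \<eta> / (4 * n)" for j
    using good[of j] unfolding good_def by blast+
  have approx:
    "(\<integral>\<^sup>+s\<in>{0..T}. ennreal ((simple_value (S j) s \<omega> - \<sigma> (X s \<omega>) $ i $ j)\<^sup>2) \<partial>lborel) \<le> ennreal a"
    "t \<in> {0..T} \<Longrightarrow> \<bar>simple_integral (\<lambda>t \<omega>. W t \<omega> $ j) (S j) t \<omega> - I j t \<omega>\<bar> \<le> a"
    if "\<omega> \<in> space M - A j" for j \<omega> t
    using good[of j] that unfolding good_def by blast+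
  define N where "N j = fst (S j)" for j
  define \<tau> where "\<tau> j = fst (snd (S j))" for j
  define \<xi> where "\<xi> j = snd (snd (S j))" for j
  have S_eq: "S j = (N j, \<tau> j, \<xi> j)" for j by (simp add: N_def \<tau>_def \<xi>_def)
  have S: "simple_process M F (N j, \<tau> j, \<xi> j)" for j using SA(1)[of j] unfolding S_eq .
  obtain C0 where C0: "\<And>j. 0 \<le> C0 j" "\<And>j s \<omega>. \<omega> \<in> space M \<Longrightarrow> \<bar>simple_value (N j, \<tau> j, \<xi> j) s \<omega>\<bar> \<le> C0 j"
    using simple_value_bounded[OF S] by metis
  define C where "C = B + (\<Sum>j\<in>UNIV. C0 j)"
  have C0C: "C0 j \<le> C" for j
    using member_le_sum[of j UNIV C0] C0(1) B unfolding C_def by simp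
  have BC: "B \<le> C" unfolding C_def using C0(1) by (simp add: sum_nonneg)
  define P where "P = (\<Union>j\<in>UNIV. \<tau> j ` {..N j})"
  have "finite P" by (simp add: P_def)
  define grid where "grid k t m \<longleftrightarrow> t 0 = 0 \<and> t m = T \<and> (\<forall>l. t l \<le> t (Suc l) \<and> t (Suc l) - t l \<le> 1 / real (Suc k) \<and> t l \<le> T \<and>
    (\<forall>p\<in>P. \<not> (t l < p \<and> p < t (Suc l))))" for k m :: nat and t :: "nat \<Rightarrow> real"
  have "\<exists>t m. grid k t m" for k
    unfolding grid_def using T \<open>finite P\<close> by (intro partition_avoiding) auto
  then obtain t m where grid: "\<And>k. grid k (t k) (m k)" by metis
  have t: "t k 0 = 0" "t k (m k) = T" "t k l \<le> t k (Suc l)" "t k (Suc l) - t k l \<le> 1 / real (Suc k)" "t k l \<le> T" for k l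
    using grid[of k] unfolding grid_def by blast+
  have tP: "\<not> (t k l < p \<and> p < t k (Suc l))" if "p \<in> P" for k l p
    using grid[of k] that unfolding grid_def by blast
  have avoid: "\<not> (t k l < \<tau> j q \<and> \<tau> j q < t k (Suc l))" if "q \<le> N j" for k l j q
    using that by (intro tP) (auto simp: P_def)
  \<comment> \<open>On a cell of length \<open>0\<close> the value of the simple process need not be measurable at its left end.\<close>
  define c where "c k l j \<omega> = (if t k l < t k (Suc l) then simple_value (N j, \<tau> j, \<xi> j) (t k (Suc l)) \<omega> else 0)" for k l j \<omega>
  have c_meas: "c k l j \<in> borel_measurable (F (t k l))" for k l j
  proof (cases "t k l < t k (Suc l)")
    case True
    then have "c k l j = simple_value (N j, \<tau> j, \<xi> j) (t k (Suc l))" unfolding c_def by auto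
    then show ?thesis using simple_value_measurable[OF S F True avoid] by simp
  next
    case False
    then have "c k l j = (\<lambda>_. 0)" unfolding c_def by auto
    then show ?thesis by simp
  qed
  have c_bound: "\<bar>c k l j \<omega>\<bar> \<le> C" if "\<omega> \<in> space M" for k l j \<omega>
    using C0(2)[OF that, of j "t k (Suc l)"] C0C[of j] B BC unfolding c_def by auto
  interpret E: euler_scheme M F W X \<mu> \<sigma> i "t k" "1 / real (Suc k)" "c k" x R B C \<epsilon> \<delta> for k
    by unfold_locales
      (fact F W t(1,3,4) X \<mu> \<sigma> drift_dominates \<mu>_bound \<sigma>_bound c_meas c_bound B BC \<epsilon> \<delta>
        | simp)+
  define L where "L k = {\<omega> \<in> space M. E.V k (m k) \<omega> \<le> 2 * \<epsilon>}" for k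
  have L: "L k \<in> events" for k unfolding L_def by (rule E.prob_low_le(1)[OF \<theta>])
  define SE where "SE = step_error CARD('n) C (\<epsilon> / 4)"
  \<comment> \<open>\<open>SE\<close> depends on \<open>C\<close> but not on the grid, so refining
    the grid makes the error vanish.\<close>
  have "(\<lambda>k. SE * sqrt (1 / real (Suc k)) * T) \<longlonglongrightarrow> SE * sqrt 0 * T"
    by (intro tendsto_intros LIMSEQ_Suc[OF lim_1_over_n])
  then have "\<forall>\<^sub>F k in sequentially. SE * sqrt (1 / real (Suc k)) * T < 1 / 2"
    by (intro order_tendstoD) auto
  then obtain k0 where k0: "\<And>k. k0 \<le> k \<Longrightarrow> SE * sqrt (1 / real (Suc k)) * T < 1 / 2"
    unfolding eventually_sequentially by blast
  have L_le: "prob (L k) \<le> \<eta> / 4" if "k0 \<le> k" for k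
  proof -
    have "prob (L k) \<le> 2 * \<epsilon> * (1 / x
      + ((B * \<delta> + \<theta> * (n * B\<^sup>2)) * T + (1 + 1 / \<theta>) * \<delta>) / (\<epsilon> / 2)^3 + SE * sqrt (1 / real (Suc k)) * T)"
      using E.prob_low_le(2)[OF \<theta>, of k "m k"] unfolding L_def SE_def n_def t(2) .
    also have "\<dots> \<le> 2 * \<epsilon> * (1 / x + 1)"
    proof (rule mult_left_mono)
      show "1 / x + ((B * \<delta> + \<theta> * (n * B\<^sup>2)) * T + (1 + 1 / \<theta>) * \<delta>) / (\<epsilon> / 2)^3
          + SE * sqrt (1 / real (Suc k)) * T \<le> 1 / x + 1"
        using drift_small k0[OF that] by linarith
    qed (use \<epsilon> in auto)
    finally show ?thesis using \<epsilon>\<eta> by linarith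
  qed
  define A' where "A' = (\<Union>q. \<Inter>k\<in>{q..}. L k) \<union> (\<Union>j\<in>UNIV. A j)"
  have A'_ev: "(\<Union>j\<in>UNIV. A j) \<in> events" using SA(2) by auto
  have "prob (\<Union>j\<in>UNIV. A j) \<le> (\<Sum>j\<in>UNIV. prob (A j))"
    by (intro finite_measure_subadditive_finite) (use SA(2) in auto)
  also have "\<dots> \<le> (\<Sum>j\<in>(UNIV::'n set). \<eta> / (4 * n))" using SA(3) by (intro sum_mono less_imp_le)
  also have "\<dots> = \<eta> / 4" using n by (simp add: n_def)
  finally have "prob A' \<le> \<eta> / 4 + \<eta> / 4"
    unfolding A'_def using prob_liminf_le[OF L L_le] A'_ev
    by (intro order_trans[OF measure_Un_le] add_mono) auto
  then have A'_prob: "prob A' < \<eta>" using \<eta> by linarith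
  have A'_events: "A' \<in> events"
    unfolding A'_def using prob_liminf_le(1)[OF L L_le] A'_ev by (rule sets.Un)

  have "\<not> (\<exists>s\<in>{0..T}. X s \<omega> $ i \<le> 0 \<and> (\<forall>u\<in>{0..<s}. X u \<omega> \<in> pos_orthant))"
    if \<omega>: "\<omega> \<in> space M - A'" and cont: "continuous_on {0..} (\<lambda>s. X s \<omega>)" and X0: "X 0 \<omega> $ i = x"
      and sde: "\<forall>s\<ge>0. X s \<omega> $ i = x + integral {0..s} (\<lambda>s. \<mu> (X s \<omega>) $ i) + (\<Sum>j\<in>UNIV. I j s \<omega>)"
      and bounded: "\<forall>s\<in>{0..T}. norm (X s \<omega>) \<le> R" for \<omega>
  proof
    assume "\<exists>s\<in>{0..T}. X s \<omega> $ i \<le> 0 \<and> (\<forall>u\<in>{0..<s}. X u \<omega> \<in> pos_orthant)"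
    then obtain s where s: "0 \<le> s" "s \<le> T" "X s \<omega> $ i \<le> 0" "\<And>u. 0 \<le> u \<Longrightarrow> u < s \<Longrightarrow> X u \<omega> \<in> pos_orthant"
      by auto
    have "s \<noteq> 0" using s(3) X0 x by auto
    then have s0: "0 < s" using s(1) by simp
    have contT: "continuous_on {0..T} (\<lambda>s. X s \<omega>)" by (rule continuous_on_subset[OF cont]) auto
    have cont_\<mu>: "continuous_on {0..T} (\<lambda>s. \<mu> (X s \<omega>) $ i)"
      by (intro continuous_on_component continuous_on_compose2[OF \<mu> contT]) auto
    have cont_\<sigma>: "continuous_on {0..T} (\<lambda>s. \<sigma> (X s \<omega>) $ i)"
      by (intro continuous_on_component continuous_on_compose2[OF \<sigma> contT]) auto
    have uc: "\<exists>d>0. \<forall>u\<in>{0..T}. \<forall>v\<in>{0..T}. \<bar>u - v\<bar> < d \<longrightarrow> dist (f u) (f v) < w'"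
      if "continuous_on {0..T} f" "0 < w'" for w' and f :: "real \<Rightarrow> 'z::metric_space"
      using compact_uniformly_continuous[OF that(1) compact_Icc] that(2)
      unfolding uniformly_continuous_on_def dist_real_def by (metis abs_minus_commute dist_commute)
    obtain d1 where d1: "0 < d1" "\<And>u v. u \<in> {0..T} \<Longrightarrow> v \<in> {0..T} \<Longrightarrow> \<bar>u - v\<bar> < d1 \<Longrightarrow> dist (\<mu> (X u \<omega>) $ i) (\<mu> (X v \<omega>) $ i) < w"
      using uc[OF cont_\<mu> w(1)] by blast
    obtain d2 where d2: "0 < d2" "\<And>u v. u \<in> {0..T} \<Longrightarrow> v \<in> {0..T} \<Longrightarrow> \<bar>u - v\<bar> < d2 \<Longrightarrow> dist (\<sigma> (X u \<omega>) $ i) (\<sigma> (X v \<omega>) $ i) < w"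
      using uc[OF cont_\<sigma> w(1)] by blast
    obtain d3 where d3: "0 < d3" "\<And>u v. u \<in> {0..T} \<Longrightarrow> v \<in> {0..T} \<Longrightarrow> \<bar>u - v\<bar> < d3 \<Longrightarrow> dist (X u \<omega>) (X v \<omega>) < \<epsilon>"
      using uc[OF contT \<epsilon>(1)] by blast
    \<comment> \<open>\<open>d1\<close> and \<open>d2\<close> bring the oscillation of the
      coefficients below \<open>w\<close>, \<open>d3\<close> keeps the component below \<epsilon>
      within one mesh width before the exit, and \<open>s\<close> ensures that the exit comes later
      than one mesh width.\<close>
    define d where "d = min (min d1 d2) (min d3 s)"
    have "0 < d" using d1 d2 d3 s0 by (simp add: d_def)
    then obtain q where q: "1 / real (Suc q) < d" using nat_approx_posE by blast
    have "\<omega> \<in> L k" if "q \<le> k" for k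
    proof -
      define h where "h = 1 / real (Suc k)"
      have "h \<le> 1 / real (Suc q)" unfolding h_def using that by (intro divide_left_mono) auto
      then have h: "h < d1" "h < d2" "h < d3" "h < s" "0 < h" using q by (auto simp: d_def h_def)
      have c_eq: "c k l j \<omega> = simple_value (N j, \<tau> j, \<xi> j) (t k (Suc l)) \<omega>" if "t k l < t k (Suc l)" for l j
        using that by (simp add: c_def del: simple_value.simps)
      have \<omega>A: "\<omega> \<in> space M - A j" for j using \<omega> by (auto simp: A'_def)
      have w_\<mu>: "\<bar>\<mu> (X u \<omega>) $ i - \<mu> (X v \<omega>) $ i\<bar> \<le> w" if "u \<in> {0..T}" "v \<in> {0..T}" "\<bar>u - v\<bar> \<le> h" for u v
        using d1(2)[OF that(1,2)] that(3) h by (simp add: dist_real_def)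
      have w_\<sigma>: "\<bar>\<sigma> (X u \<omega>) $ i $ j - \<sigma> (X v \<omega>) $ i $ j\<bar> \<le> w" if "u \<in> {0..T}" "v \<in> {0..T}" "\<bar>u - v\<bar> \<le> h" for j u v
      proof -
        have "\<bar>(\<sigma> (X u \<omega>) $ i - \<sigma> (X v \<omega>) $ i) $ j\<bar> \<le> norm (\<sigma> (X u \<omega>) $ i - \<sigma> (X v \<omega>) $ i)"
          by (rule component_le_norm_cart)
        also have "\<dots> < w" using d2(2)[OF that(1,2)] that(3) h by (simp add: dist_norm)
        finally show ?thesis by simp
      qed
      have "E.V k (m k) \<omega> \<le> 2 * \<epsilon>"
      proof (rule E.V_low_at_exit[of \<omega> k "m k" T s])
        show "\<bar>E.Z k l \<omega> - X (t k l) \<omega> $ i\<bar> \<le> \<delta>" for l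
        proof -
          have "\<bar>E.Z k l \<omega> - X (t k l) \<omega> $ i\<bar> \<le> w * t k l + real CARD('n) * a"
          proof (rule E.Z_close[OF t(5) S avoid c_eq cont_\<mu> w_\<mu>[unfolded h_def]])
            show "X s \<omega> $ i = x + integral {0..s} (\<lambda>s. \<mu> (X s \<omega>) $ i) + (\<Sum>j\<in>UNIV. I j s \<omega>)" if "0 \<le> s" for s
              using sde that by blast
            show "\<bar>simple_integral (\<lambda>s \<omega>. W s \<omega> $ j) (N j, \<tau> j, \<xi> j) s \<omega> - I j s \<omega>\<bar> \<le> a" if "s \<in> {0..T}" for j s
              using approx(2)[OF \<omega>A that, of j] unfolding S_eq .
          qed
          also have "\<dots> \<le> w * T + n * a" using t(5)[of k l] w by (simp add: n_def mult_left_mono)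
          also have "\<dots> \<le> \<delta>" using wT a(2) \<delta>(1) by simp
          finally show ?thesis .
        qed
        show "(\<Sum>l\<le>l. E.err k l \<omega>) \<le> \<delta>" for l
        proof -
          have "(\<Sum>l\<le>l. E.err k l \<omega>) \<le> real CARD('n) * (2 * a + 2 * w\<^sup>2 * T)"
          proof (rule E.err_sum_le[OF t(5) S avoid c_eq _ w_\<sigma>[unfolded h_def]])
            show "continuous_on {0..T} (\<lambda>s. \<sigma> (X s \<omega>) $ i $ j)" for j
              by (rule continuous_on_component[OF cont_\<sigma>])
            show "(\<integral>\<^sup>+s\<in>{0..T}. ennreal ((simple_value (N j, \<tau> j, \<xi> j) s \<omega> - \<sigma> (X s \<omega>) $ i $ j)\<^sup>2) \<partial>lborel) \<le> ennreal a" for j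
              using approx(1)[OF \<omega>A, of j] unfolding S_eq .
          qed (use w a in auto)
          then show ?thesis using w2 by (simp add: n_def)
        qed
        show "X u \<omega> $ i \<le> \<epsilon>" if "s - 1 / real (Suc k) \<le> u" "u < s" for u
        proof -
          have u: "\<bar>u - s\<bar> \<le> h" "u \<in> {0..T}" using that h s unfolding h_def by auto
          have "\<bar>(X u \<omega> - X s \<omega>) $ i\<bar> \<le> norm (X u \<omega> - X s \<omega>)" by (rule component_le_norm_cart)
          also have "\<dots> < \<epsilon>" using d3(2)[of u s] u s h by (simp add: dist_norm)
          finally show ?thesis using s(3) by simp
        qed
      qed (use \<omega> t(2,5) bounded s h in \<open>auto simp: h_def\<close>)
      then show ?thesis using \<omega> by (simp add: L_def)
    qed
    then have "\<omega> \<in> A'" unfolding A'_def by auto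
    then show False using \<omega> by simp
  qed
  then show ?thesis using A'_events A'_prob by blast
qed

text \<open>\<open>P\<close> need not define a measurable set; the intersection of events of
  probability below 1 / (k + 1) is a null set containing all failures.\<close>

lemma (in prob_space) AE_of_outer_measure_small:
  assumes "\<And>\<eta>. 0 < \<eta> \<Longrightarrow> \<exists>A\<in>events. prob A < \<eta> \<and> (\<forall>\<omega>\<in>space M - A. P \<omega>)"
  shows "AE \<omega> in M. P \<omega>"
proof -
  have "\<exists>A. A \<in> events \<and> prob A < 1 / real (Suc k) \<and> (\<forall>\<omega>\<in>space M - A. P \<omega>)" for k
    using assms[of "1 / real (Suc k)"] by auto
  then obtain A where A: "\<And>k. A k \<in> events" "\<And>k. prob (A k) < 1 / real (Suc k)" "\<And>k \<omega>. \<omega> \<in> space M - A k \<Longrightarrow> P \<omega>"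
    by metis
  define N where "N = (\<Inter>k. A k)"
  have N: "N \<in> events" unfolding N_def using A(1) by auto
  have "prob N \<le> 1 / real (Suc k)" for k
    using finite_measure_mono[of N "A k"] A(1,2)[of k] by (force simp: N_def)
  then have "prob N \<le> 0"
    by (intro LIMSEQ_le_const[OF LIMSEQ_Suc[OF lim_1_over_n]]) auto
  then have "N \<in> null_sets M" using N by (auto simp: null_sets_def emeasure_eq_measure measure_le_0_iff)
  then show ?thesis
    by (rule AE_I') (use A(3) in \<open>auto simp: N_def\<close>)
qed

section \<open>Coefficient bounds and conclusion\<close>

lemma linear_growth_bounded:
  fixes f :: "'a::real_normed_vector \<Rightarrow> 'b::real_normed_vector"
  assumes "linear_growth f"
  shows "\<exists>B\<ge>0. \<forall>y. norm y \<le> R \<longrightarrow> norm (f y) \<le> B"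
proof -
  obtain K where K: "\<And>y. norm (f y) \<le> K * (1 + norm y)" using assms unfolding linear_growth_def by blast
  have "norm (f y) \<le> \<bar>K\<bar> * (1 + \<bar>R\<bar>)" if "norm y \<le> R" for y
  proof -
    have "norm (f y) \<le> K * (1 + norm y)" by (rule K)
    also have "\<dots> \<le> \<bar>K\<bar> * (1 + \<bar>R\<bar>)" using that by (intro mult_mono) auto
    finally show ?thesis .
  qed
  then show ?thesis by (intro exI[of _ "\<bar>K\<bar> * (1 + \<bar>R\<bar>)"]) auto
qed

lemma m_fn_diag: "m_fn \<sigma> y $ i $ i = (\<Sum>j\<in>UNIV. (\<sigma> y $ i $ j)\<^sup>2)"
  by (simp add: m_fn_def matrix_matrix_mult_def transpose_def power2_eq_square)

text \<open>\<open>a_fn\<close> is a sum of squares, so being nonzero it is positive and the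
  denominators in 1 / y_i < \<mu>_i / a_i can be cleared. The result is the sign condition for the
  drift of the reciprocal.\<close>

lemma b_minus_drift_dominates:
  assumes nz: "\<forall>i. \<forall>y\<in>pos_orthant. a_fn \<sigma> i y \<noteq> 0"
    and bm: "\<forall>i. \<forall>r>0. b_minus \<mu> \<sigma> i r > ereal (1 / r)" and y: "y \<in> pos_orthant"
  shows "(\<Sum>j\<in>UNIV. (\<sigma> y $ i $ j)\<^sup>2) \<le> \<mu> y $ i * y $ i"
proof -
  have yi: "0 < y $ i" using y by (simp add: pos_orthant_def)
  have a: "a_fn \<sigma> i y = (\<Sum>j\<in>UNIV. (\<sigma> y $ i $ j)\<^sup>2)" by (simp add: a_fn_def m_fn_diag)
  have "0 \<le> a_fn \<sigma> i y" unfolding a by (intro sum_nonneg) auto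
  then have a0: "0 < a_fn \<sigma> i y" using nz y by (simp add: order_less_le)
  have "ereal (1 / y $ i) < b_minus \<mu> \<sigma> i (y $ i)" using bm yi by blast
  also have "\<dots> \<le> ereal (b_fn \<mu> \<sigma> i y)" unfolding b_minus_def by (rule INF_lower) (simp add: y p_fn_def)
  finally have "1 / y $ i < \<mu> y $ i / a_fn \<sigma> i y" by (simp add: b_fn_def)
  then show ?thesis using yi a0 unfolding a[symmetric] by (simp add: field_simps)
qed

theorem theorem3p1:
  fixes \<mu> :: "real ^ 'n \<Rightarrow> real ^ 'n"
    and \<sigma> :: "real ^ 'n \<Rightarrow> real ^ 'n ^ 'n"
    and \<rho>1 :: "real \<Rightarrow> real"
    and D :: "(real ^ 'n) set"
    and M :: "'w measure"
    and F :: "real \<Rightarrow> 'w measure"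
    and W X :: "real \<Rightarrow> 'w \<Rightarrow> real ^ 'n"
    and x0 :: "real ^ 'n"
  assumes rho_strict_mono: "strict_mono_on {0..} \<rho>1"
    and rho_zero: "\<rho>1 0 = 0"
    and rho_integral:
      "\<forall>\<epsilon>>0. (\<integral>\<^sup>+s\<in>{0<..\<epsilon>}. ennreal (1 / (\<rho>1 s)\<^sup>2) \<partial>lborel) = \<infinity>"
    and mu_cont: "continuous_on UNIV \<mu>" and mu_growth: "linear_growth \<mu>"
    and sigma_cont: "continuous_on UNIV \<sigma>" and sigma_growth: "linear_growth \<sigma>"
    and a_nonzero: "\<forall>i. \<forall>x\<in>pos_orthant. a_fn \<sigma> i x \<noteq> 0"
    and a_plus_finite: "\<forall>i. \<forall>r>0. a_plus \<sigma> i r < \<infinity>"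
    and D_nhd: "nhd_of D (frontier pos_orthant)"
    and mu_pos: "\<forall>x\<in>D. \<forall>i. \<mu> x $ i > 0"
    and b_minus_bound: "\<forall>i. \<forall>r>0. b_minus \<mu> \<sigma> i r > ereal (1 / r)"
    and sigma_tilde:
      "\<exists>s :: real \<Rightarrow> real.
         (\<forall>x\<in>D \<inter> pos_orthant. \<forall>i. m_fn \<sigma> x $ i $ i \<le> real CARD('n) ^ 3 * (s (p_fn i x))\<^sup>2) \<and>
         (\<exists>\<epsilon>>0. \<forall>R>0. \<exists>C>0. \<forall>r1\<in>{0..R}. \<forall>r2\<in>{0..R}. \<bar>r1 - r2\<bar> \<le> \<epsilon> \<longrightarrow>
            \<bar>(s r1)\<^sup>2 - (s r2)\<^sup>2\<bar> \<le> C * \<bar>r1 - r2\<bar> \<and>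
            \<bar>sqrt r1 * s r1 - sqrt r2 * s r2\<bar> \<le> C * \<rho>1 \<bar>r1 - r2\<bar>)"
    and space: "filtered_prob_space M F"
    and wiener: "wiener_process M F W"
    and solution: "sde_solution M F W \<mu> \<sigma> X"
    and initial: "AE \<omega> in M. X 0 \<omega> = x0"
    and initial_pos: "\<forall>i. x0 $ i > 0"
  shows "AE \<omega> in M. \<forall>i. \<forall>t\<ge>0. X t \<omega> $ i > 0"
proof -
  interpret prob_space M using space by (simp add: filtered_prob_space_def)
  obtain I where ada: "adapted F X" and paths: "continuous_paths M X"
    and I: "\<And>i j. has_ito_integral M F (\<lambda>t \<omega>. W t \<omega> $ j) (\<lambda>t \<omega>. \<sigma> (X t \<omega>) $ i $ j) (I i j)"
    and eq: "AE \<omega> in M. \<forall>t\<ge>0. \<forall>i. X t \<omega> $ i = X 0 \<omega> $ i + integral {0..t} (\<lambda>s. \<mu> (X s \<omega>) $ i) + (\<Sum>j\<in>UNIV. I i j t \<omega>)"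
    using solution unfolding sde_solution_def by blast
  define noexit where "noexit i T R \<omega> \<longleftrightarrow> (continuous_on {0..} (\<lambda>s. X s \<omega>) \<longrightarrow> X 0 \<omega> $ i = x0 $ i \<longrightarrow>
    (\<forall>s\<ge>0. X s \<omega> $ i = x0 $ i + integral {0..s} (\<lambda>s. \<mu> (X s \<omega>) $ i) + (\<Sum>j\<in>UNIV. I i j s \<omega>)) \<longrightarrow>
    (\<forall>s\<in>{0..T}. norm (X s \<omega>) \<le> R) \<longrightarrow>
    \<not> (\<exists>s\<in>{0..T}. X s \<omega> $ i \<le> 0 \<and> (\<forall>u\<in>{0..<s}. X u \<omega> \<in> pos_orthant)))" for i and T R :: real and \<omega>
  have noexit: "AE \<omega> in M. noexit i T R \<omega>" if T: "0 < T" for i T R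
  proof (rule AE_of_outer_measure_small)
    fix \<eta> :: real assume \<eta>: "0 < \<eta>"
    obtain B1 where B1: "0 \<le> B1" "\<And>y. norm y \<le> R \<Longrightarrow> norm (\<mu> y) \<le> B1"
      using linear_growth_bounded[OF mu_growth] by blast
    obtain B2 where B2: "0 \<le> B2" "\<And>y. norm y \<le> R \<Longrightarrow> norm (\<sigma> y) \<le> B2"
      using linear_growth_bounded[OF sigma_growth] by blast
    have "\<bar>\<mu> y $ i\<bar> \<le> max B1 B2" if "norm y \<le> R" for y
      using component_le_norm_cart[of "\<mu> y" i] B1(2)[OF that] by simp
    moreover have "\<bar>\<sigma> y $ i $ j\<bar> \<le> max B1 B2" if "norm y \<le> R" for y j
      using component_le_norm_cart[of "\<sigma> y $ i" j] Finite_Cartesian_Product.norm_nth_le[of "\<sigma> y" i] B2(2)[OF that] by simp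
    ultimately show "\<exists>A\<in>events. prob A < \<eta> \<and> (\<forall>\<omega>\<in>space M - A. noexit i T R \<omega>)"
      unfolding noexit_def
      by (intro exit_event_small[OF space wiener ada mu_cont sigma_cont _ _ _ _ I T _ \<eta>, where B = "max B1 B2"]
          b_minus_drift_dominates[OF a_nonzero b_minus_bound])
        (use B1(1) initial_pos in auto)
  qed
  \<comment> \<open>Integer horizons and radii suffice, because a continuous path is bounded on
    compact intervals; countably many statements cost one null set. \<open>Suc T\<close> keeps the
    horizon positive.\<close>
  have "AE \<omega> in M. \<forall>i. \<forall>T R :: nat. noexit i (real (Suc T)) (real R) \<omega>"
    unfolding AE_all_countable by (auto intro!: noexit AE_finite_allI simp: AE_all_countable)
  with eq initial paths[unfolded continuous_paths_def] show ?thesis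
  proof eventually_elim
    case (elim \<omega>)
    have cont: "continuous_on {0..r} (\<lambda>s. X s \<omega>)" for r
      by (rule continuous_on_subset[OF elim(3)]) auto
    have "X r \<omega> \<in> pos_orthant" if r: "0 \<le> r" for r
    proof (rule ccontr)
      assume "X r \<omega> \<notin> pos_orthant"
      \<comment> \<open>The times up to \<open>r\<close> spent outside the open orthant form a
        compact set; its least element is the first exit time, before which all components are
        positive.\<close>
      define E where "E = {0..r} \<inter> (\<lambda>s. X s \<omega>) -` (- pos_orthant)"
      have "closed E" unfolding E_def
        by (rule continuous_closed_preimage[OF cont]) (use open_pos_orthant in \<open>auto simp: closed_def\<close>)
      moreover have "bounded E" by (rule bounded_subset[OF bounded_closed_interval[of 0 r]]) (auto simp: E_def)
      ultimately have "compact E" by (simp add: compact_eq_bounded_closed)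
      moreover have "E \<noteq> {}" using r \<open>X r \<omega> \<notin> pos_orthant\<close> by (auto simp: E_def)
      ultimately obtain s where s: "s \<in> E" "\<And>u. u \<in> E \<Longrightarrow> s \<le> u" using compact_attains_inf by metis
      then obtain i where i: "X s \<omega> $ i \<le> 0" by (auto simp: E_def pos_orthant_def not_less)
      have before: "X u \<omega> \<in> pos_orthant" if "0 \<le> u" "u < s" for u
        using s that by (force simp: E_def)
      obtain T :: nat where T: "s \<le> real T" using real_arch_simple by blast
      have "bounded ((\<lambda>s. X s \<omega>) ` {0..real (Suc T)})"
        by (intro compact_imp_bounded compact_continuous_image cont compact_Icc)
      then obtain R0 where R0: "\<And>u. u \<in> {0..real (Suc T)} \<Longrightarrow> norm (X u \<omega>) \<le> R0"
        unfolding bounded_iff by blast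
      obtain R :: nat where R: "R0 \<le> real R" using real_arch_simple by blast
      have "noexit i (real (Suc T)) (real R) \<omega>" using elim(4) by blast
      moreover have "norm (X u \<omega>) \<le> real R" if "u \<in> {0..real (Suc T)}" for u using R0[OF that] R by linarith
      moreover have "s \<in> {0..real (Suc T)}" using s(1) T by (auto simp: E_def)
      moreover have "\<forall>s\<ge>0. X s \<omega> $ i = x0 $ i + integral {0..s} (\<lambda>s. \<mu> (X s \<omega>) $ i) + (\<Sum>j\<in>UNIV. I i j s \<omega>)"
        using elim(1,2) by metis
      ultimately show False unfolding noexit_def using elim(2,3) i before by (metis atLeastLessThan_iff)
    qed
    then show ?case by (auto simp: pos_orthant_def)
  qed
qed

end
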